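(* Let $n\ge1$ be an integer, $\sigma<1-n$, $2\leq p\leq\infty$ and $\frac1p+\frac1{p'}=1$. There exists a constant $C=C_\sigma>0$ such that $$\Vert\partial_t^kS(t)g\Vert_{H^{\sigma-k}_p(\mathbb{R}^n)}\leq C\,t^{-\frac n2(1-\frac2p)}\Vert g\Vert_{L^{p'}(\mathbb{R}^n)},$$ $$\Vert\partial_t^{k-1}S(t)\Delta g\Vert_{H^{\sigma-k+1}_p(\mathbb{R}^n)}\leq C\,t^{-\frac n2(1-\frac2p)}\Vert g\Vert_{H^2_{p'}(\mathbb{R}^n)},$$ for all $g\in\mathscr{S}(\mathbb{R}^n)$, $k=1,2$ and $t>0$.
   Context: For $t\geq 0$, $S(t)$ is the Fourier multiplier operator on $\mathbb{R}^n$ with symbol $$m(\xi,t)=e^{-\frac{|\xi|^2t}{2(1+|\xi|^2)}}\,\frac{2(1+|\xi|^2)}{|\xi|^2\sqrt{3+4|\xi|^2}}\,\sin\left(\frac{|\xi|^2\sqrt{3+4|\xi|^2}\,t}{2(1+|\xi|^2)}\right)$$ (equal to $t$ at $\xi=0$), and $\partial_t^kS(t)$ is the Fourier multiplier operator with symbol $\partial_t^km(\xi,t)$. $\mathscr{S}(\mathbb{R}^n)$ is the Schwartz space. $H^\sigma_p(\mathbb{R}^n)=(I-\Delta)^{-\sigma/2}L^p(\mathbb{R}^n)$ is the Bessel potential space with norm $\Vert f\Vert_{H^\sigma_p}=\Vert(I-\Delta)^{\sigma/2}f\Vert_{L^p}$. The dimension $n$ is fixed; $C_\sigma$ denotes a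 constant depending on $\sigma$ (and $n$) but not on $g$ or $t$. *)

theory Defs
  imports "HOL-Analysis.Analysis" "HOL-Probability.Essential_Supremum"
begin

definition partial :: "'n::finite \<Rightarrow> (real^'n \<Rightarrow> complex) \<Rightarrow> real^'n \<Rightarrow> complex" where
  "partial i f x = frechet_derivative f (at x) (axis i 1)"

text \<open>A list of coordinates encodes an iterated partial derivative. Differentiability of all of
  these iterates makes \<open>f\<close> a \<open>C\<^sup>\<infinity>\<close> function; the second clause is the finiteness of
  all seminorms \<open>sup \<bar>x\<bar>\<^sup>N \<bar>\<partial>\<^sup>\<beta> f(x)\<bar>\<close>.\<close>

definition schwartz :: "(real^'n::finite \<Rightarrow> complex) set" where
  "schwartz = {f. \<forall>js. (\<forall>x. foldr partial js f differentiable (at x)) \<and>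
     (\<forall>N::nat. bounded (range (\<lambda>x. norm x ^ N *\<^sub>R foldr partial js f x)))}"

definition laplacian :: "(real^'n::finite \<Rightarrow> complex) \<Rightarrow> real^'n \<Rightarrow> complex" where
  "laplacian f x = (\<Sum>i\<in>UNIV. partial i (partial i f) x)"

definition fourier :: "(real^'n::finite \<Rightarrow> complex) \<Rightarrow> real^'n \<Rightarrow> complex" where
  "fourier f \<xi> = (LINT x|lborel. cis (- (x \<bullet> \<xi>)) * f x)"

definition inv_fourier :: "(real^'n::finite \<Rightarrow> complex) \<Rightarrow> real^'n \<Rightarrow> complex" where
  "inv_fourier h x = complex_of_real (1 / (2 * pi) ^ CARD('n)) * (LINT \<xi>|lborel. cis (x \<bullet> \<xi>) * h \<xi>)"

text \<open>All symbols used below are smooth in \<open>\<xi>\<close>, with derivatives of at most polynomial growth,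
  so their multiplier operators map the Schwartz space to itself. They are applied only to Schwartz
  functions, for which all the integrals involved converge absolutely.\<close>

definition fourier_multiplier ::
    "(real^'n::finite \<Rightarrow> real) \<Rightarrow> (real^'n \<Rightarrow> complex) \<Rightarrow> real^'n \<Rightarrow> complex" where
  "fourier_multiplier a f = inv_fourier (\<lambda>\<xi>. complex_of_real (a \<xi>) * fourier f \<xi>)"

definition symbol_m :: "real^'n::finite \<Rightarrow> real \<Rightarrow> real" where
  "symbol_m \<xi> t = (if \<xi> = 0 then t else
     exp (- ((norm \<xi>)\<^sup>2 * t / (2 * (1 + (norm \<xi>)\<^sup>2)))) *
     (2 * (1 + (norm \<xi>)\<^sup>2) / ((norm \<xi>)\<^sup>2 * sqrt (3 + 4 * (norm \<xi>)\<^sup>2))) *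
     sin ((norm \<xi>)\<^sup>2 * sqrt (3 + 4 * (norm \<xi>)\<^sup>2) * t / (2 * (1 + (norm \<xi>)\<^sup>2))))"

text \<open>\<open>dt_S k t\<close> is \<open>\<partial>\<^sub>t\<^sup>k S(t)\<close>; in particular \<open>dt_S 0 t\<close> is \<open>S(t)\<close>.\<close>

definition dt_S :: "nat \<Rightarrow> real \<Rightarrow> (real^'n::finite \<Rightarrow> complex) \<Rightarrow> real^'n \<Rightarrow> complex" where
  "dt_S k t = fourier_multiplier (\<lambda>\<xi>. (deriv ^^ k) (symbol_m \<xi>) t)"

text \<open>For measurable \<open>f\<close> the norm is \<open>\<infinity>\<close> exactly outside \<open>L\<^sup>p\<close>, so a finite
  upper bound includes membership.\<close>

definition Lp_norm :: "ennreal \<Rightarrow> (real^'n::finite \<Rightarrow> complex) \<Rightarrow> ennreal" where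
  "Lp_norm p f =
     (if p = \<infinity> then esssup lborel (\<lambda>x. ennreal (norm (f x)))
      else let I = (\<integral>\<^sup>+x. ennreal (norm (f x) powr enn2real p) \<partial>lborel)
           in if I = \<infinity> then \<infinity> else ennreal (enn2real I powr (1 / enn2real p)))"

definition bessel_op :: "real \<Rightarrow> (real^'n::finite \<Rightarrow> complex) \<Rightarrow> real^'n \<Rightarrow> complex" where
  "bessel_op s = fourier_multiplier (\<lambda>\<xi>. (1 + (norm \<xi>)\<^sup>2) powr (s / 2))"

text \<open>\<open>bessel_op s\<close> is \<open>(I - \<Delta>)\<^bsup>s/2\<^esup>\<close>, so this is the norm of \<open>H\<^sup>s\<^sub>p\<close>.
  It is meant for Schwartz functions \<open>f\<close>, where it needs no extension to distributions.\<close>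

definition bessel_norm :: "real \<Rightarrow> ennreal \<Rightarrow> (real^'n::finite \<Rightarrow> complex) \<Rightarrow> ennreal" where
  "bessel_norm s p f = Lp_norm p (bessel_op s f)"

end

theory Submission
  imports Defs "HOL-Probability.Characteristic_Functions"
begin

text \<open>
  Every operator involved is a multiplier \<open>b\<close> with
  \<open>\<bar>b(\<xi>)\<bar> \<le> 3 (1 + \<bar>\<xi>\<bar>\<^sup>2) powr ((\<sigma> - 1) / 2) * exp (- \<bar>\<xi>\<bar>\<^sup>2 t / (2 (1 + \<bar>\<xi>\<bar>\<^sup>2)))\<close>,
  applied to \<open>g\<close> or to \<open>(I - \<Delta>) g\<close>. Since \<open>\<sigma> - 1 < - n\<close>, the weight is integrable at high
  frequencies, where the exponential decays like \<open>exp (- t / 4)\<close>, while at low frequencies the bound is a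
  heat kernel; hence the \<open>L\<^sup>1\<close> norm of \<open>b\<close> is at most a constant times \<open>t powr (- n / 2)\<close>.
  This bounds the operator from \<open>L\<^sup>1\<close> to \<open>L\<^sup>\<infinity>\<close>, Plancherel bounds it on \<open>L\<^sup>2\<close>,
  and the remaining exponents follow by real interpolation with a constant uniform in \<open>p\<close>.
\<close>

section \<open>Gaussians\<close>

text \<open>The symbol of \<open>S(t)\<close> equals \<open>t\<close> at the origin, so it has no
  bound uniform in \<open>t\<close>; its time derivatives and its product with
  \<open>(norm \<xi>)\<^sup>2\<close> are free of this growth, and only they and their combinations
  have to be estimated. The condition on \<sigma> enters through a single weight, whose
  integrability it expresses.

  The constant must not depend on \<open>p\<close>. The delicate range is \<open>p\<close> near
  \<open>2\<close>; for large \<open>p\<close> the interpolation constant grows only polynomially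
  before its p-th root is taken.

  A second obstacle is the form of the Bessel norm: \<open>bessel_op\<close> transforms a function
  that is itself given as an inverse transform. Composing the two multipliers rests on Fourier
  inversion, whose integrability hypothesis concerns that inverse transform. Both inversion and the
  Plancherel inequality are obtained by inserting a Gaussian factor that widens to
  \<open>1\<close>.\<close>

lemma nn_integral_lborel_affine:
  fixes f :: "'a::euclidean_space \<Rightarrow> ennreal"
  assumes [measurable]: "f \<in> borel_measurable borel" and c: "c \<noteq> 0"
  shows "(\<integral>\<^sup>+x. f x \<partial>lborel) = ennreal (\<bar>c\<bar> ^ DIM('a)) * (\<integral>\<^sup>+x. f (t + c *\<^sub>R x) \<partial>lborel)"
  by (subst lborel_affine[OF c, of t])
     (simp add: nn_integral_density nn_integral_distr nn_integral_cmult)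

lemma integral_lborel_affine:
  fixes f :: "'a::euclidean_space \<Rightarrow> 'b::{banach, second_countable_topology}"
  assumes c: "c \<noteq> 0" and [measurable]: "f \<in> borel_measurable borel"
  shows "(LINT x|lborel. f x) = \<bar>c\<bar> ^ DIM('a) *\<^sub>R (LINT x|lborel. f (t + c *\<^sub>R x))"
proof -
  have "(LINT x|lborel. f x) = 
      (LINT x|density (distr lborel borel (\<lambda>x. t + c *\<^sub>R x)) (\<lambda>_. ennreal (\<bar>c\<bar>^DIM('a))). f x)"
    using lborel_affine[OF c, of t] by simp
  also have "\<dots> = \<bar>c\<bar> ^ DIM('a) *\<^sub>R (LINT x|lborel. f (t + c *\<^sub>R x))"
    by (subst integral_density) (auto simp: integral_distr)
  finally show ?thesis .
qed

lemma integrable_lborel_affine: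
  fixes f :: "'a::euclidean_space \<Rightarrow> 'b::{banach, second_countable_topology}"
  assumes c: "c \<noteq> 0" and f: "integrable lborel f"
  shows "integrable lborel (\<lambda>x. f (t + c *\<^sub>R x))"
proof -
  have [measurable]: "f \<in> borel_measurable borel" using f by auto
  have "ennreal (\<bar>c\<bar> ^ DIM('a)) * (\<integral>\<^sup>+x. norm (f (t + c *\<^sub>R x)) \<partial>lborel) < \<infinity>"
    using f by (subst nn_integral_lborel_affine[symmetric, OF _ c]) (auto simp: integrable_iff_bounded)
  then show ?thesis
    using c by (auto simp: integrable_iff_bounded ennreal_mult_less_top)
qed

text \<open>Gaussians are tensor products, and power weights are dominated by tensor products, so
  their integrals over the space reduce to one dimension.\<close>

lemma
  fixes f :: "'a::euclidean_space \<Rightarrow> real \<Rightarrow> 'b::{real_normed_field, banach, second_countable_topology}"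
  assumes f: "\<And>b. b \<in> Basis \<Longrightarrow> integrable lborel (f b)"
  shows integrable_lborel_prod: "integrable lborel (\<lambda>x. \<Prod>b\<in>Basis. f b (x \<bullet> b))"
    and integral_lborel_prod:
      "(LINT x|lborel. (\<Prod>b\<in>Basis. f b (x \<bullet> b))) = (\<Prod>b\<in>Basis. LINT x|lborel. f b x)"
proof -
  interpret product_sigma_finite "\<lambda>_::'a. lborel :: real measure" ..
  have [measurable]: "\<And>b. b \<in> Basis \<Longrightarrow> f b \<in> borel_measurable borel"
    using f by auto
  show "integrable lborel (\<lambda>x. \<Prod>b\<in>Basis. f b (x \<bullet> b))"
    by (subst lborel_eq, subst integrable_distr_eq) (auto intro!: product_integrable_prod f)
  show "(LINT x|lborel. (\<Prod>b\<in>Basis. f b (x \<bullet> b))) = (\<Prod>b\<in>Basis. LINT x|lborel. f b x)"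
    by (subst lborel_eq, subst integral_distr) (auto intro!: product_integral_prod f)
qed

text \<open>The parameter is an inverse width: the transform takes \<open>c\<close> to
  \<open>1 / c\<close>, letting \<open>c\<close> tend to \<open>0\<close> gives the constant
  \<open>1\<close> of the summability arguments, and \<open>c = sqrt (t / 2)\<close> gives the heat
  factor with exponent \<open>(norm x)\<^sup>2 * t / 4\<close>.\<close>

definition gauss :: "real \<Rightarrow> 'a::euclidean_space \<Rightarrow> real" where
  "gauss c x = exp (- ((c * norm x)\<^sup>2 / 2))"

lemma gauss_nonneg [simp]: "0 \<le> gauss c x"
  and gauss_le_1: "gauss c x \<le> 1"
  and gauss_uminus [simp]: "gauss c (- x) = gauss c x"
  by (auto simp: gauss_def)

lemma gauss_measurable [measurable]: "gauss c \<in> borel_measurable borel"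
  unfolding gauss_def[abs_def] by simp

lemma gauss_eq_prod: "gauss c x = (\<Prod>b\<in>Basis. exp (- ((c * (x \<bullet> b))\<^sup>2 / 2)))"
proof -
  have "(norm x)\<^sup>2 = (\<Sum>b\<in>Basis. (x \<bullet> b)\<^sup>2)"
    unfolding power2_norm_eq_inner by (subst euclidean_inner) (simp add: power2_eq_square)
  then show ?thesis
    by (simp add: gauss_def exp_sum[symmetric] power_mult_distrib sum_distrib_left
        sum_negf sum_divide_distrib)
qed

lemma cis_inner_eq_prod: "cis (- (x \<bullet> y)) = (\<Prod>b\<in>Basis. cis (- ((x \<bullet> b) * (y \<bullet> b))))"
proof -
  have "- (x \<bullet> y) = (\<Sum>b\<in>Basis. - ((x \<bullet> b) * (y \<bullet> b)))"
    by (subst euclidean_inner) (simp add: sum_negf)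
  moreover have "cis (\<Sum>b\<in>A. h b) = (\<Prod>b\<in>A. cis (h b))" if "finite A" for A :: "'a set" and h
    using that by induction (auto simp flip: cis_mult)
  ultimately show ?thesis by simp
qed

lemma cis_measurable [measurable]: "cis \<in> borel_measurable borel"
  by (intro borel_measurable_continuous_onI continuous_intros)

text \<open>The characteristic function of the standard normal distribution, taken at
  \<open>- (z / c)\<close>, supplies the value; substituting \<open>c * x\<close> introduces the
  width.\<close>

lemma
  fixes c z :: real
  assumes c: "c > 0"
  shows integrable_cis_gauss_real:
      "integrable lborel (\<lambda>x. cis (- (x * z)) * complex_of_real (exp (- ((c * x)\<^sup>2 / 2))))" (is ?int)
    and integral_cis_gauss_real:
      "(LINT x|lborel. cis (- (x * z)) * complex_of_real (exp (- ((c * x)\<^sup>2 / 2)))) =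
       complex_of_real (sqrt (2 * pi) / c * exp (- ((z / c)\<^sup>2 / 2)))" (is ?eq)
proof -
  let ?g = "\<lambda>x. std_normal_density x *\<^sub>R cis (- (x * (z / c)))"
  have g: "integrable lborel ?g"
    by (rule Bochner_Integration.integrable_bound[where f=std_normal_density])
       (auto intro: integrable_normal_density)
  have "iexp (- (z / c) * x) = cis (- (x * (z / c)))" for x
    by (simp add: cis_conv_exp mult_ac)
  then have "char std_normal_distribution (- (z / c)) = (LINT x|std_normal_distribution. cis (- (x * (z / c))))"
    unfolding char_def by presburger
  also have "\<dots> = (LINT x|lborel. ?g x)"
    by (subst integral_density) (auto simp: normal_density_nonneg)
  finally have I: "(LINT x|lborel. ?g x) = complex_of_real (exp (- ((z / c)\<^sup>2 / 2)))"
    by (simp add: char_std_normal_distribution)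
  have eq: "cis (- (x * z)) * complex_of_real (exp (- ((c * x)\<^sup>2 / 2))) = sqrt (2 * pi) *\<^sub>R ?g (0 + c * x)" for x
  proof -
    have "(0 + c * x) * (z / c) = x * z" using c by simp
    moreover have "sqrt (2 * pi) * std_normal_density (0 + c * x) = exp (- ((c * x)\<^sup>2 / 2))"
      by (simp add: std_normal_density_def)
    ultimately show ?thesis
      by (simp only: scaleR_scaleR) (simp add: scaleR_conv_of_real mult.commute)
  qed
  show ?int
    unfolding eq using g c
    by (intro integrable_scaleR_right lborel_integrable_real_affine) auto
  have "complex_of_real (exp (- ((z / c)\<^sup>2 / 2))) = c *\<^sub>R (LINT x|lborel. ?g (0 + c * x))"
    using lborel_integral_real_affine[of c ?g 0] c I by simp
  then have "(LINT x|lborel. ?g (0 + c * x)) = complex_of_real (exp (- ((z / c)\<^sup>2 / 2)) / c)"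
    using c by (simp add: scaleR_conv_of_real field_simps)
  then show ?eq
    unfolding eq by (simp only: integral_scaleR_right) (simp add: scaleR_conv_of_real)
qed

lemma
  fixes z :: "real^'n::finite"
  assumes c: "c > 0"
  shows integrable_gauss_complex: "integrable lborel (\<lambda>x. cis (- (x \<bullet> z)) * complex_of_real (gauss c x))"
    and fourier_gauss: "fourier (\<lambda>x. complex_of_real (gauss c x)) z =
      complex_of_real ((sqrt (2 * pi) / c) ^ CARD('n) * gauss (1 / c) z)"
proof -
  let ?f = "\<lambda>b x. cis (- (x * (z \<bullet> b))) * complex_of_real (exp (- ((c * x)\<^sup>2 / 2)))"
  have eq: "cis (- (x \<bullet> z)) * complex_of_real (gauss c x) = (\<Prod>b\<in>Basis. ?f b (x \<bullet> b))" for x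
    by (simp add: cis_inner_eq_prod gauss_eq_prod prod.distrib)
  show "integrable lborel (\<lambda>x. cis (- (x \<bullet> z)) * complex_of_real (gauss c x))"
    unfolding eq by (intro integrable_lborel_prod integrable_cis_gauss_real c)
  show "fourier (\<lambda>x. complex_of_real (gauss c x)) z =
      complex_of_real ((sqrt (2 * pi) / c) ^ CARD('n) * gauss (1 / c) z)"
    unfolding fourier_def eq
    by (subst integral_lborel_prod, rule integrable_cis_gauss_real[OF c])
       (simp only: integral_cis_gauss_real[OF c], 
        simp add: gauss_eq_prod prod.distrib prod_dividef power_divide)
qed

lemma integrable_gauss: "c > 0 \<Longrightarrow> integrable lborel (gauss c :: real^'n::finite \<Rightarrow> real)"
  using integrable_Re[OF integrable_gauss_complex[of c "0::real^'n"]] by simp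

lemma integral_gauss: "c > 0 \<Longrightarrow> (LINT x|lborel. gauss c (x::real^'n::finite)) = (sqrt (2 * pi) / c) ^ CARD('n)"
  using fourier_gauss[of c "0::real^'n"] unfolding fourier_def
  by (simp add: gauss_def flip: of_real_power of_real_divide)

lemma nn_integral_gauss:
  "c > 0 \<Longrightarrow> (\<integral>\<^sup>+x. ennreal (gauss c (x::real^'n::finite)) \<partial>lborel) = ennreal ((sqrt (2 * pi) / c) ^ CARD('n))"
  by (subst nn_integral_eq_integral) (auto simp: integrable_gauss integral_gauss)

section \<open>Fourier inversion\<close>

lemma integrable_bounded_kernel:
  fixes u :: "'a::euclidean_space \<Rightarrow> complex" and v :: "'b::euclidean_space \<Rightarrow> complex"
  assumes u: "integrable lborel u" and v: "integrable lborel v"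
    and [measurable]: "case_prod k \<in> borel_measurable (lborel \<Otimes>\<^sub>M lborel)"
    and k: "\<And>x y. norm (k x y) \<le> 1"
  shows "integrable (lborel \<Otimes>\<^sub>M lborel) (\<lambda>(x, y). u x * (k x y * v y))"
proof (rule integrableI_bounded)
  have [measurable]: "u \<in> borel_measurable borel" "v \<in> borel_measurable borel"
    using u v by auto
  show "(\<lambda>(x, y). u x * (k x y * v y)) \<in> borel_measurable (lborel \<Otimes>\<^sub>M lborel)"
    by measurable
  have "norm (u x * (k x y * v y)) \<le> norm (u x) * norm (v y)" for x y
    using k[of x y] by (auto simp: norm_mult intro!: mult_left_mono mult_left_le_one_le)
  then have "(\<integral>\<^sup>+z. norm (case z of (x, y) \<Rightarrow> u x * (k x y * v y)) \<partial>(lborel \<Otimes>\<^sub>M lborel)) \<le>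
     (\<integral>\<^sup>+z. ennreal (norm (u (fst z))) * ennreal (norm (v (snd z))) \<partial>(lborel \<Otimes>\<^sub>M lborel))"
    by (intro nn_integral_mono) (auto simp: ennreal_mult[symmetric])
  also have "\<dots> = (\<integral>\<^sup>+x. norm (u x) \<partial>lborel) * (\<integral>\<^sup>+y. norm (v y) \<partial>lborel)"
    by (subst lborel.nn_integral_fst[symmetric]) (auto simp: nn_integral_cmult nn_integral_multc)
  also have "\<dots> < \<infinity>"
    using u v by (auto simp: integrable_iff_bounded ennreal_mult_less_top)
  finally show "(\<integral>\<^sup>+z. norm (case z of (x, y) \<Rightarrow> u x * (k x y * v y)) \<partial>(lborel \<Otimes>\<^sub>M lborel)) < \<infinity>" .
qed

text \<open>General in the kernel because both signs of the phase occur: one in the multiplication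
  formula, the other in the Plancherel inequality, where a conjugated transform is unfolded.\<close>

lemma integral_kernel_swap:
  fixes u :: "'a::euclidean_space \<Rightarrow> complex" and v :: "'b::euclidean_space \<Rightarrow> complex"
  assumes "integrable lborel u" "integrable lborel v"
    and "case_prod k \<in> borel_measurable (lborel \<Otimes>\<^sub>M lborel)"
    and "\<And>x y. norm (k x y) \<le> 1"
  shows "(LINT x|lborel. u x * (LINT y|lborel. k x y * v y)) = (LINT y|lborel. (LINT x|lborel. u x * k x y) * v y)"
  using lborel_pair.Fubini_integral[OF integrable_bounded_kernel[OF assms]]
  by (simp add: mult.assoc flip: integral_mult_right_zero integral_mult_left_zero)

lemma cis_inner_measurable:
  "(\<lambda>(x, y::'a::euclidean_space). cis (- (x \<bullet> y))) \<in> borel_measurable (lborel \<Otimes>\<^sub>M lborel)"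
  by measurable

lemma integrable_cis_mult:
  assumes "integrable lborel f" and [measurable]: "h \<in> borel_measurable borel"
  shows "integrable lborel (\<lambda>x. cis (h x) * f x)"
proof -
  have [measurable]: "f \<in> borel_measurable borel" using assms(1) by auto
  show ?thesis
    by (rule Bochner_Integration.integrable_bound[OF assms(1)]) (auto simp: norm_mult)
qed

lemma fourier_measurable [measurable]:
  fixes f :: "real^'n::finite \<Rightarrow> complex"
  assumes [measurable]: "f \<in> borel_measurable borel"
  shows "fourier f \<in> borel_measurable borel"
proof -
  have "(\<lambda>y. LINT x|lborel. cis (- (x \<bullet> y)) * f x) \<in> borel_measurable lborel"
    by (rule lborel.borel_measurable_lebesgue_integral) measurable
  then show ?thesis by (simp add: fourier_def[abs_def])
qed

lemma inv_fourier_eq: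
  fixes f :: "real^'n::finite \<Rightarrow> complex"
  shows "inv_fourier f x = complex_of_real (1 / (2 * pi) ^ CARD('n)) * fourier f (- x)"
  by (simp add: inv_fourier_def fourier_def inner_commute)

lemma inv_fourier_measurable [measurable]:
  fixes f :: "real^'n::finite \<Rightarrow> complex"
  assumes [measurable]: "f \<in> borel_measurable borel"
  shows "inv_fourier f \<in> borel_measurable borel"
  unfolding inv_fourier_eq[abs_def] by measurable

lemma norm_fourier_le: "norm (fourier f y) \<le> (LINT x|lborel. norm (f x))"
  unfolding fourier_def by (rule order_trans[OF integral_norm_bound]) (simp add: norm_mult)

lemma continuous_fourier:
  fixes f :: "real^'n::finite \<Rightarrow> complex"
  assumes f: "integrable lborel f"
  shows "continuous_on UNIV (fourier f)"
proof (rule continuous_at_imp_continuous_on, intro ballI)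
  fix y
  have [measurable]: "f \<in> borel_measurable borel" using f by auto
  show "isCont (fourier f) y"
    unfolding continuous_at_sequentially comp_def
  proof safe
    fix Y assume Y: "Y \<longlonglongrightarrow> y"
    show "(\<lambda>n. fourier f (Y n)) \<longlonglongrightarrow> fourier f y"
      unfolding fourier_def
    proof (rule integral_dominated_convergence)
      show "integrable lborel (\<lambda>x. norm (f x))" using f by auto
      show "AE x in lborel. (\<lambda>n. cis (- (x \<bullet> Y n)) * f x) \<longlonglongrightarrow> cis (- (x \<bullet> y)) * f x"
        by (intro AE_I2 tendsto_intros tendsto_cis Y)
    qed (auto simp: norm_mult)
  qed
qed

lemma fourier_mult_formula:
  fixes u v :: "real^'n::finite \<Rightarrow> complex"
  assumes "integrable lborel u" "integrable lborel v"
  shows "(LINT x|lborel. fourier u x * v x) = (LINT x|lborel. u x * fourier v x)"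
  using integral_kernel_swap[OF assms cis_inner_measurable]
  by (simp add: fourier_def inner_commute mult_ac)

lemma fourier_modulated:
  fixes v :: "real^'n::finite \<Rightarrow> complex"
  shows "fourier (\<lambda>x. cis (- (x \<bullet> a)) * v x) y = fourier v (y + a)"
proof -
  have "cis (- (x \<bullet> y)) * cis (- (x \<bullet> a)) = cis (- (x \<bullet> (y + a)))" for x
    by (simp add: cis_mult inner_add_right)
  then show ?thesis
    by (simp only: fourier_def mult.assoc[symmetric])
qed

lemma integrable_gauss_bounded:
  fixes F :: "real^'n::finite \<Rightarrow> complex"
  assumes "c > 0" and [measurable]: "F \<in> borel_measurable borel" and F: "\<And>x. norm (F x) \<le> K"
  shows "integrable lborel (\<lambda>x. complex_of_real (gauss c x) * F x)"
proof (rule Bochner_Integration.integrable_bound[where f="\<lambda>x. gauss c x * K"])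
  show "integrable lborel (\<lambda>x::real^'n. gauss c x * K)"
    using integrable_gauss[OF assms(1)] by auto
  have "K \<ge> 0" using F norm_ge_zero order_trans by blast
  then show "AE x in lborel. norm (complex_of_real (gauss c x) * F x) \<le> norm (gauss c x * K)"
    using F by (auto simp: norm_mult intro!: mult_left_mono)
qed auto

text \<open>A factor \<open>gauss (c m)\<close> with \<open>c m\<close> tending to \<open>0\<close>
  is inserted into the outer integral. The multiplication formula moves the transform onto the
  modulated Gaussian, which becomes an approximate identity centred at \<open>- y\<close>.
  Continuity and boundedness of \<open>F\<close> give the limit there at every point; integrability
  of \<open>fourier F\<close> gives the limit on the other side. Two forward transforms are composed
  so that both orders of inversion follow by reflection.\<close>

lemma fourier_inversion:
  fixes F :: "real^'n::finite \<Rightarrow> complex"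
  assumes F: "integrable lborel F" and cont: "continuous_on UNIV F" and bdd: "\<And>x. norm (F x) \<le> K"
    and f: "integrable lborel (fourier F)"
  shows "fourier (fourier F) y = (2 * pi) ^ CARD('n) *\<^sub>R F (- y)"
proof -
  have [measurable]: "F \<in> borel_measurable borel" using F by auto
  define c where "c = (\<lambda>m::nat. inverse (real (Suc m)))"
  have c0: "c m > 0" for m by (simp add: c_def)
  have clim: "c \<longlonglongrightarrow> 0" unfolding c_def by (rule LIMSEQ_inverse_real_of_nat)
  let ?N = "sqrt (2 * pi) ^ CARD('n)"
  have eq: "(LINT x|lborel. cis (- (x \<bullet> y)) * (complex_of_real (gauss (c m) x) * fourier F x)) =
     ?N *\<^sub>R (LINT z|lborel. complex_of_real (gauss 1 z) * F (- y + c m *\<^sub>R z))" for m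
  proof -
    let ?v = "\<lambda>x. cis (- (x \<bullet> y)) * complex_of_real (gauss (c m) x)"
    have v: "integrable lborel ?v"
      by (rule integrable_gauss_complex[OF c0])
    have "(LINT x|lborel. cis (- (x \<bullet> y)) * (complex_of_real (gauss (c m) x) * fourier F x)) =
      (LINT x|lborel. F x * fourier ?v x)"
      using fourier_mult_formula[OF F v] by (simp add: mult_ac)
    also have "\<dots> = (LINT x|lborel. F x * complex_of_real ((sqrt (2 * pi) / c m) ^ CARD('n) * gauss (1 / c m) (x + y)))"
      unfolding fourier_modulated by (subst fourier_gauss[OF c0]) simp
    also have "\<dots> = c m ^ CARD('n) *\<^sub>R (LINT z|lborel. F (- y + c m *\<^sub>R z) * complex_of_real ((sqrt (2 * pi) / c m) ^ CARD('n) * gauss (1 / c m) (- y + c m *\<^sub>R z + y)))"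
      using c0[of m] by (subst integral_lborel_affine[of "c m" _ "- y"]) (auto simp del: of_real_mult)
    also have "\<dots> = c m ^ CARD('n) *\<^sub>R (LINT z|lborel. (sqrt (2 * pi) / c m) ^ CARD('n) *\<^sub>R (complex_of_real (gauss 1 z) * F (- y + c m *\<^sub>R z)))"
    proof -
      have "gauss (1 / c m) (- y + c m *\<^sub>R z + y) = gauss 1 z" for z
        using c0[of m] by (simp add: gauss_def)
      then show ?thesis
        by (simp add: scaleR_conv_of_real[where 'a=complex] mult_ac)
    qed
    also have "\<dots> = ?N *\<^sub>R (LINT z|lborel. complex_of_real (gauss 1 z) * F (- y + c m *\<^sub>R z))"
      using c0[of m] by (simp add: power_divide)
    finally show ?thesis .
  qed
  have L: "(\<lambda>m. LINT x|lborel. cis (- (x \<bullet> y)) * (complex_of_real (gauss (c m) x) * fourier F x))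
     \<longlonglongrightarrow> (LINT x|lborel. cis (- (x \<bullet> y)) * fourier F x)"
  proof (rule integral_dominated_convergence)
    show "integrable lborel (\<lambda>x. norm (fourier F x))" using f by auto
    have "(\<lambda>m. complex_of_real (gauss (c m) x)) \<longlonglongrightarrow> complex_of_real (exp (- ((0 * norm x)\<^sup>2 / 2)))" for x :: "real^'n"
      unfolding gauss_def by (intro tendsto_intros clim) auto
    then have "(\<lambda>m. complex_of_real (gauss (c m) x)) \<longlonglongrightarrow> 1" for x :: "real^'n" by simp
    then have "(\<lambda>m. cis (- (x \<bullet> y)) * (complex_of_real (gauss (c m) x) * fourier F x)) \<longlonglongrightarrow>
      cis (- (x \<bullet> y)) * (1 * fourier F x)" for x
      by (intro tendsto_intros)
    then show "AE x in lborel. (\<lambda>m. cis (- (x \<bullet> y)) * (complex_of_real (gauss (c m) x) * fourier F x)) \<longlonglongrightarrow>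
      cis (- (x \<bullet> y)) * fourier F x" by simp
    show "AE x in lborel. norm (cis (- (x \<bullet> y)) * (complex_of_real (gauss (c m) x) * fourier F x)) \<le> norm (fourier F x)" for m
      by (auto simp: norm_mult intro!: mult_left_le_one_le gauss_le_1)
  qed auto
  have "(\<lambda>m. LINT z|lborel. complex_of_real (gauss 1 z) * F (- y + c m *\<^sub>R z)) \<longlonglongrightarrow>
     (LINT z|lborel. complex_of_real (gauss 1 (z::real^'n)) * F (- y))"
  proof (rule integral_dominated_convergence)
    show "integrable lborel (\<lambda>z::real^'n. gauss 1 z * K)"
      using integrable_gauss[of 1] by auto
    have "(\<lambda>m. F (- y + c m *\<^sub>R z)) \<longlonglongrightarrow> F (- y + 0 *\<^sub>R z)" for z
      by (rule isCont_tendsto_compose[of _ F], use cont in \<open>simp add: continuous_on_eq_continuous_at\<close>)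
         (intro tendsto_intros clim)
    then show "AE z in lborel. (\<lambda>m. complex_of_real (gauss 1 z) * F (- y + c m *\<^sub>R z)) \<longlonglongrightarrow> complex_of_real (gauss 1 z) * F (- y)"
      by (intro AE_I2 tendsto_intros) auto
    show "AE z in lborel. norm (complex_of_real (gauss 1 z) * F (- y + c m *\<^sub>R z)) \<le> gauss 1 z * K" for m
      using bdd by (auto simp: norm_mult intro!: mult_left_mono)
  qed auto
  also have "(LINT z|lborel. complex_of_real (gauss 1 (z::real^'n)) * F (- y)) = ?N *\<^sub>R F (- y)"
    using integral_gauss[where 'n='n, of 1] by (simp add: scaleR_conv_of_real flip: of_real_power)
  finally have "(\<lambda>m. ?N *\<^sub>R (LINT z|lborel. complex_of_real (gauss 1 z) * F (- y + c m *\<^sub>R z))) \<longlonglongrightarrow> ?N *\<^sub>R (?N *\<^sub>R F (- y))"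
    by (intro tendsto_intros)
  \<comment> \<open>One factor \<open>?N\<close> stems from the transform of the Gaussian, the other
    from its total mass.\<close>
  moreover have "?N * ?N = (2 * pi) ^ CARD('n)"
    unfolding power_mult_distrib[symmetric] real_sqrt_mult_self by simp
  ultimately show ?thesis
    using LIMSEQ_unique[OF L[unfolded eq]] by (simp only: fourier_def[of "fourier F"] scaleR_scaleR)
qed

lemma fourier_inv_fourier:
  fixes F :: "real^'n::finite \<Rightarrow> complex"
  assumes F: "integrable lborel F" and cont: "continuous_on UNIV F" and bdd: "\<And>x. norm (F x) \<le> K"
    and f: "integrable lborel (inv_fourier F)"
  shows "fourier (inv_fourier F) = F"
proof
  fix y
  let ?k = "complex_of_real (1 / (2 * pi) ^ CARD('n))"
  have [measurable]: "F \<in> borel_measurable borel" using F by auto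
  have "fourier F = (\<lambda>x. (2 * pi) ^ CARD('n) *\<^sub>R inv_fourier F (0 + (-1) *\<^sub>R x))"
    by (simp add: fun_eq_iff)
       (simp add: inv_fourier_eq scaleR_conv_of_real)
  then have int: "integrable lborel (fourier F)"
    by (simp only:) (intro integrable_scaleR_right integrable_lborel_affine f; simp)
  have "fourier (inv_fourier F) y = (LINT x|lborel. ?k * (cis (- (x \<bullet> y)) * fourier F (- x)))"
    by (simp add: fourier_def[of "inv_fourier F"] inv_fourier_eq mult_ac)
  also have "\<dots> = ?k * (LINT x|lborel. cis (- (x \<bullet> y)) * fourier F (- x))"
    by (rule integral_mult_right_zero)
  also have "(LINT x|lborel. cis (- (x \<bullet> y)) * fourier F (- x)) = fourier (fourier F) (- y)"
    unfolding fourier_def[of "fourier F"]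
    by (subst (2) integral_lborel_affine[of "-1" _ 0]) (auto simp: inner_minus_left)
  finally show "fourier (inv_fourier F) y = F y"
    using fourier_inversion[OF F cont bdd int, of "- y"] by (simp add: scaleR_conv_of_real)
qed

lemma inv_fourier_fourier:
  fixes F :: "real^'n::finite \<Rightarrow> complex"
  assumes "integrable lborel F" "continuous_on UNIV F" "\<And>x. norm (F x) \<le> K"
    and "integrable lborel (fourier F)"
  shows "inv_fourier (fourier F) = F"
  using fourier_inversion[OF assms] by (simp add: fun_eq_iff inv_fourier_eq scaleR_conv_of_real)

section \<open>The Plancherel inequality\<close>

lemma nn_integral_lborel_shift:
  fixes f :: "'a::euclidean_space \<Rightarrow> ennreal"
  assumes [measurable]: "f \<in> borel_measurable borel"
  shows "(\<integral>\<^sup>+x. f (x - a) \<partial>lborel) = (\<integral>\<^sup>+x. f x \<partial>lborel)"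
  using nn_integral_lborel_affine[of f 1 "- a"] by simp

lemma cnj_measurable [measurable]: "cnj \<in> borel_measurable borel"
  by (intro borel_measurable_continuous_onI continuous_intros)

text \<open>Young's inequality for the quadratic form of an even kernel. Bounding the product by
  half the sum of the squares separates the variables; translation invariance and evenness then
  evaluate the integral of \<open>G\<close> in either variable.\<close>

lemma nn_integral_convolution_le:
  fixes f :: "'a::euclidean_space \<Rightarrow> real" and G :: "'a \<Rightarrow> real"
  assumes [measurable]: "f \<in> borel_measurable borel" "G \<in> borel_measurable borel"
    and G: "\<And>x. 0 \<le> G x" and sym: "\<And>x. G (- x) = G x"
  shows "(\<integral>\<^sup>+x. \<integral>\<^sup>+y. ennreal (f x * f y * G (x - y)) \<partial>lborel \<partial>lborel) \<le>
    (\<integral>\<^sup>+x. ennreal (G x) \<partial>lborel) * (\<integral>\<^sup>+x. ennreal ((f x)\<^sup>2) \<partial>lborel)" (is "?L \<le> ?I * ?J")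
proof -
  have "f x * f y \<le> (f x)\<^sup>2 / 2 + (f y)\<^sup>2 / 2" for x y
    using sum_squares_bound[of "f x" "f y"] by simp
  then have "f x * f y * G (x - y) \<le> ((f x)\<^sup>2 / 2 + (f y)\<^sup>2 / 2) * G (x - y)" for x y
    by (intro mult_right_mono G)
  then have le: "f x * f y * G (x - y) \<le> (f x)\<^sup>2 / 2 * G (x - y) + (f y)\<^sup>2 / 2 * G (x - y)" for x y
    by (simp add: distrib_right)
  have "?L \<le> (\<integral>\<^sup>+x. \<integral>\<^sup>+y. ennreal ((f x)\<^sup>2 / 2) * ennreal (G (x - y)) + ennreal ((f y)\<^sup>2 / 2) * ennreal (G (x - y)) \<partial>lborel \<partial>lborel)"
    using le G by (intro nn_integral_mono) (simp add: ennreal_mult[symmetric] ennreal_plus[symmetric] del: ennreal_plus)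
  also have "\<dots> = (\<integral>\<^sup>+x. \<integral>\<^sup>+y. ennreal ((f x)\<^sup>2 / 2) * ennreal (G (x - y)) \<partial>lborel \<partial>lborel)
     + (\<integral>\<^sup>+x. \<integral>\<^sup>+y. ennreal ((f y)\<^sup>2 / 2) * ennreal (G (x - y)) \<partial>lborel \<partial>lborel)"
    by (simp add: nn_integral_add)
  also have "(\<integral>\<^sup>+x. \<integral>\<^sup>+y. ennreal ((f x)\<^sup>2 / 2) * ennreal (G (x - y)) \<partial>lborel \<partial>lborel) = 
     (\<integral>\<^sup>+x. ennreal ((f x)\<^sup>2 / 2) * ?I \<partial>lborel)"
  proof (intro nn_integral_cong)
    fix x
    have "(\<integral>\<^sup>+y. ennreal (G (x - y)) \<partial>lborel) = (\<integral>\<^sup>+y. ennreal (G (y - x)) \<partial>lborel)"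
      using sym[of "x - _"] by (simp add: sym[of "x - y" for y, symmetric])
    then show "(\<integral>\<^sup>+y. ennreal ((f x)\<^sup>2 / 2) * ennreal (G (x - y)) \<partial>lborel) = ennreal ((f x)\<^sup>2 / 2) * ?I"
      by (simp add: nn_integral_cmult nn_integral_lborel_shift[where f="\<lambda>y. ennreal (G y)"])
  qed
  also have "(\<integral>\<^sup>+x. \<integral>\<^sup>+y. ennreal ((f y)\<^sup>2 / 2) * ennreal (G (x - y)) \<partial>lborel \<partial>lborel) = 
    (\<integral>\<^sup>+y. \<integral>\<^sup>+x. ennreal ((f y)\<^sup>2 / 2) * ennreal (G (x - y)) \<partial>lborel \<partial>lborel)"
    by (rule lborel_pair.Fubini') measurable
  also have "\<dots> = (\<integral>\<^sup>+y. ennreal ((f y)\<^sup>2 / 2) * ?I \<partial>lborel)"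
    by (simp add: nn_integral_cmult nn_integral_lborel_shift[where f="\<lambda>y. ennreal (G y)"])
  also have "(\<integral>\<^sup>+y. ennreal ((f y)\<^sup>2 / 2) * ?I \<partial>lborel) + (\<integral>\<^sup>+y. ennreal ((f y)\<^sup>2 / 2) * ?I \<partial>lborel)
     = (\<integral>\<^sup>+y. (ennreal ((f y)\<^sup>2 / 2) + ennreal ((f y)\<^sup>2 / 2)) * ?I \<partial>lborel)"
    by (simp add: nn_integral_add[symmetric] distrib_right)
  also have "\<dots> = ?J * ?I"
    by (simp add: nn_integral_multc ennreal_plus[symmetric] del: ennreal_plus)
  finally show ?thesis by (simp add: mult.commute)
qed

lemma cnj_fourier:
  fixes f :: "real^'n::finite \<Rightarrow> complex"
  shows "cnj (fourier f y) = (LINT z|lborel. cis (y \<bullet> z) * cnj (f z))"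
proof -
  have "cnj (fourier f y) = (LINT z|lborel. cnj (cis (- (z \<bullet> y)) * f z))"
    unfolding fourier_def by (rule Bochner_Integration.integral_cnj[symmetric])
  also have "\<dots> = (LINT z|lborel. cis (y \<bullet> z) * cnj (f z))"
    by (simp only: complex_cnj_mult cis_cnj minus_minus inner_commute)
  finally show ?thesis .
qed

text \<open>For merely integrable \<open>f\<close> the squared transform need not be integrable; the
  Gaussian makes it so and legitimates the exchange of integrals. The integral then becomes a
  quadratic form with the Gaussian kernel \<open>?G\<close>, to which Young's inequality
  applies.\<close>

lemma nn_integral_fourier_gauss_le:
  fixes f :: "real^'n::finite \<Rightarrow> complex"
  assumes f: "integrable lborel f" and c: "c > 0"
  shows "(\<integral>\<^sup>+y. ennreal ((norm (fourier f y))\<^sup>2 * gauss c y) \<partial>lborel) \<le>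
    ennreal ((2 * pi) ^ CARD('n)) * (\<integral>\<^sup>+x. ennreal ((norm (f x))\<^sup>2) \<partial>lborel)"
proof -
  have [measurable]: "f \<in> borel_measurable borel" using f by auto
  let ?G = "\<lambda>x::real^'n. (sqrt (2 * pi) / c) ^ CARD('n) * gauss (1 / c) x"
  \<comment> \<open>Chosen so that the product of \<open>fourier f\<close> and \<open>?k\<close> is
    the given integrand and the multiplication formula can shift the first transform onto
    \<open>?k\<close>.\<close>
  let ?k = "\<lambda>y. complex_of_real (gauss c y) * cnj (fourier f y)"
  have k: "integrable lborel ?k"
    by (rule integrable_gauss_bounded[OF c, where K="LINT x|lborel. norm (f x)"]) (auto intro: norm_fourier_le)
  have fk: "fourier f y * ?k y = complex_of_real ((norm (fourier f y))\<^sup>2 * gauss c y)" for y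
    using complex_norm_square[of "fourier f y"] by (simp add: mult_ac)
  have int: "integrable lborel (\<lambda>y. (norm (fourier f y))\<^sup>2 * gauss c y)"
  proof (rule Bochner_Integration.integrable_bound[where f="\<lambda>x. gauss c x * (LINT x|lborel. norm (f x))\<^sup>2"])
    show "integrable lborel (\<lambda>x::real^'n. gauss c x * (LINT x|lborel. norm (f x))\<^sup>2)"
      using integrable_gauss[OF c] by auto
    show "AE x in lborel. norm ((norm (fourier f x))\<^sup>2 * gauss c x) \<le> norm (gauss c x * (LINT x|lborel. norm (f x))\<^sup>2)"
      by (auto simp: norm_mult mult.commute intro!: mult_left_mono power_mono norm_fourier_le)
  qed auto
  have cnjf: "integrable lborel (\<lambda>x. cnj (f x))" using f by simp
  have Fk: "fourier ?k x = (LINT z|lborel. complex_of_real (?G (x - z)) * cnj (f z))" for x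
  proof -
    let ?u = "\<lambda>y. cis (- (y \<bullet> x)) * complex_of_real (gauss c y)"
    have u: "integrable lborel ?u" by (rule integrable_gauss_complex[OF c])
    have "fourier ?k x = (LINT y|lborel. ?u y * (LINT z|lborel. cis (y \<bullet> z) * cnj (f z)))"
      by (subst fourier_def) (simp only: cnj_fourier mult.assoc)
    also have "\<dots> = (LINT z|lborel. (LINT y|lborel. ?u y * cis (y \<bullet> z)) * cnj (f z))"
      by (rule integral_kernel_swap[OF u cnjf]) auto
    finally have eq: "fourier ?k x = (LINT z|lborel. (LINT y|lborel. ?u y * cis (y \<bullet> z)) * cnj (f z))" .
    have K: "(LINT y|lborel. ?u y * cis (y \<bullet> z)) = complex_of_real (?G (x - z))" for z
    proof -
      have "?u y * cis (y \<bullet> z) = cis (- (y \<bullet> (x - z))) * complex_of_real (gauss c y)" for y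
        using cis_mult[of "- (y \<bullet> x)" "y \<bullet> z"] by (simp add: inner_diff_right mult_ac)
      then show ?thesis
        using fourier_gauss[OF c, of "x - z"] by (simp only: fourier_def)
    qed
    show ?thesis unfolding eq K ..
  qed
  have "(\<integral>\<^sup>+y. ennreal ((norm (fourier f y))\<^sup>2 * gauss c y) \<partial>lborel) =
    ennreal (LINT y|lborel. (norm (fourier f y))\<^sup>2 * gauss c y)"
    by (rule nn_integral_eq_integral[OF int]) auto
  also have "\<dots> \<le> ennreal (norm (LINT y|lborel. fourier f y * ?k y))"
    unfolding fk integral_complex_of_real by (intro ennreal_leI) simp
  also have "(LINT y|lborel. fourier f y * ?k y) = (LINT x|lborel. f x * fourier ?k x)"
    by (rule fourier_mult_formula[OF f k])
  \<comment> \<open>A non-integrable function has Bochner integral \<open>0\<close>, so the bound by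
    the nonnegative integral holds in that case too.\<close>
  also have "ennreal (norm \<dots>) \<le> (\<integral>\<^sup>+x. norm (f x * fourier ?k x) \<partial>lborel)"
    by (cases "integrable lborel (\<lambda>x. f x * fourier ?k x)")
       (auto simp: integral_norm_bound_ennreal not_integrable_integral_eq)
  also have "\<dots> \<le> (\<integral>\<^sup>+x. \<integral>\<^sup>+z. ennreal (norm (f x) * norm (f z) * ?G (x - z)) \<partial>lborel \<partial>lborel)"
  proof (rule nn_integral_mono)
    fix x
    have "ennreal (norm (fourier ?k x)) \<le> (\<integral>\<^sup>+z. norm (complex_of_real (?G (x - z)) * cnj (f z)) \<partial>lborel)"
      unfolding Fk by (cases "integrable lborel (\<lambda>z. complex_of_real (?G (x - z)) * cnj (f z))")
       (auto simp: integral_norm_bound_ennreal not_integrable_integral_eq simp del: of_real_mult)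
    then have "ennreal (norm (f x)) * ennreal (norm (fourier ?k x)) \<le>
       ennreal (norm (f x)) * (\<integral>\<^sup>+z. norm (complex_of_real (?G (x - z)) * cnj (f z)) \<partial>lborel)"
      by (intro mult_left_mono) auto
    also have "\<dots> = (\<integral>\<^sup>+z. ennreal (norm (f x)) * norm (complex_of_real (?G (x - z)) * cnj (f z)) \<partial>lborel)"
      by (intro nn_integral_cmult[symmetric]) measurable
    also have "\<dots> = (\<integral>\<^sup>+z. ennreal (norm (f x) * norm (f z) * ?G (x - z)) \<partial>lborel)"
      using c by (intro nn_integral_cong) (simp add: norm_mult ennreal_mult[symmetric] norm_power norm_divide mult_ac)
    finally show "ennreal (norm (f x * fourier ?k x)) \<le> (\<integral>\<^sup>+z. ennreal (norm (f x) * norm (f z) * ?G (x - z)) \<partial>lborel)"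
      by (simp add: norm_mult ennreal_mult)
  qed
  also have "\<dots> \<le> (\<integral>\<^sup>+x. ennreal (?G x) \<partial>lborel) * (\<integral>\<^sup>+x. ennreal ((norm (f x))\<^sup>2) \<partial>lborel)"
    using c by (intro nn_integral_convolution_le) auto
  \<comment> \<open>Height and width of \<open>?G\<close> compensate, so its mass does not depend on
    \<open>c\<close>; this makes the bound survive the limit of vanishing \<open>c\<close>.\<close>
  also have "(\<integral>\<^sup>+x. ennreal (?G x) \<partial>lborel) = ennreal ((2 * pi) ^ CARD('n))"
  proof -
    have "(\<integral>\<^sup>+x. ennreal (?G x) \<partial>lborel) = ennreal ((sqrt (2 * pi) / c) ^ CARD('n)) * ennreal ((sqrt (2 * pi) / (1 / c)) ^ CARD('n))"
      using c nn_integral_gauss[where 'n='n, of "1/c"] by (simp add: ennreal_mult nn_integral_cmult)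
    also have "\<dots> = ennreal ((2 * pi) ^ CARD('n))"
    proof -
      have "(sqrt (2 * pi) / c) ^ CARD('n) * (sqrt (2 * pi) / (1 / c)) ^ CARD('n) = (2 * pi) ^ CARD('n)"
        unfolding power_mult_distrib[symmetric] using c by simp
      then show ?thesis
        using c by (metis divide_nonneg_pos ennreal_mult less_imp_le real_sqrt_ge_zero zero_le_power
            zero_less_divide_1_iff pi_ge_zero mult_nonneg_nonneg zero_le_numeral)
    qed
    finally show ?thesis .
  qed
  finally show ?thesis .
qed

text \<open>Only an upper bound is wanted, so Fatou's lemma suffices to remove the Gaussian. The
  right-hand side may be infinite.\<close>

lemma nn_integral_fourier_le:
  fixes f :: "real^'n::finite \<Rightarrow> complex"
  assumes f: "integrable lborel f"
  shows "(\<integral>\<^sup>+y. ennreal ((norm (fourier f y))\<^sup>2) \<partial>lborel) \<le>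
    ennreal ((2 * pi) ^ CARD('n)) * (\<integral>\<^sup>+x. ennreal ((norm (f x))\<^sup>2) \<partial>lborel)"
proof -
  have [measurable]: "f \<in> borel_measurable borel" using f by auto
  let ?g = "\<lambda>m y. ennreal ((norm (fourier f y))\<^sup>2 * gauss (inverse (real (Suc m))) y)"
  have lim: "(\<lambda>m. ?g m y) \<longlonglongrightarrow> ennreal ((norm (fourier f y))\<^sup>2)" for y
  proof -
    have "(\<lambda>m. ?g m y) \<longlonglongrightarrow> ennreal ((norm (fourier f y))\<^sup>2 * exp (- ((0 * norm y)\<^sup>2 / 2)))"
      unfolding gauss_def by (intro tendsto_ennrealI tendsto_intros LIMSEQ_inverse_real_of_nat) auto
    then show ?thesis by simp
  qed
  have "(\<integral>\<^sup>+y. ennreal ((norm (fourier f y))\<^sup>2) \<partial>lborel) = (\<integral>\<^sup>+y. liminf (\<lambda>m. ?g m y) \<partial>lborel)"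
    by (intro nn_integral_cong lim_imp_Liminf[OF sequentially_bot lim, symmetric])
  also have "\<dots> \<le> liminf (\<lambda>m. \<integral>\<^sup>+y. ?g m y \<partial>lborel)"
    by (rule nn_integral_liminf) measurable
  also have "\<dots> \<le> limsup (\<lambda>m. \<integral>\<^sup>+y. ?g m y \<partial>lborel)"
    by (rule Liminf_le_Limsup) simp
  also have "\<dots> \<le> ennreal ((2 * pi) ^ CARD('n)) * (\<integral>\<^sup>+x. ennreal ((norm (f x))\<^sup>2) \<partial>lborel)"
    by (intro Limsup_bounded always_eventually allI nn_integral_fourier_gauss_le[OF f]) simp
  finally show ?thesis .
qed

section \<open>Fourier multipliers with bounded integrable symbol\<close>

lemma integrable_mult_bounded:
  fixes F :: "'a::euclidean_space \<Rightarrow> complex" and b :: "'a \<Rightarrow> real"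
  assumes b: "integrable lborel b" and [measurable]: "F \<in> borel_measurable borel" and F: "\<And>x. norm (F x) \<le> K"
  shows "integrable lborel (\<lambda>x. complex_of_real (b x) * F x)"
proof (rule Bochner_Integration.integrable_bound[where f="\<lambda>x. \<bar>b x\<bar> * K"])
  have [measurable]: "b \<in> borel_measurable borel" using b by auto
  show "integrable lborel (\<lambda>x. \<bar>b x\<bar> * K)" using b by auto
  have "K \<ge> 0" using F norm_ge_zero order_trans by blast
  then show "AE x in lborel. norm (complex_of_real (b x) * F x) \<le> norm (\<bar>b x\<bar> * K)"
    using F by (auto simp: norm_mult abs_mult intro!: mult_left_mono)
  show "(\<lambda>x. complex_of_real (b x) * F x) \<in> borel_measurable lborel" by measurable
qed

text \<open>\<open>A\<close> bounds the operator on \<open>L\<^sup>2\<close> and \<open>B\<close>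
  bounds it from \<open>L\<^sup>1\<close> to \<open>L\<^sup>\<infinity>\<close>; the power of
  \<open>2 * pi\<close> in \<open>bB\<close> offsets the normalisation of
  \<open>inv_fourier\<close>.\<close>

locale bounded_multiplier =
  fixes b :: "real^'n::finite \<Rightarrow> real" and A B :: real
  assumes b: "integrable lborel b"
    and bA: "\<And>y. \<bar>b y\<bar> \<le> A"
    and bB: "(LINT y|lborel. \<bar>b y\<bar>) \<le> (2 * pi) ^ CARD('n) * B"
begin

lemma b_measurable [measurable]: "b \<in> borel_measurable borel"
  using b by auto

lemma A_nonneg: "0 \<le> A"
  using bA[of 0] by linarith

lemma integrable_symbol_fourier:
  assumes "integrable lborel f"
  shows "integrable lborel (\<lambda>y. complex_of_real (b y) * fourier f y)"
proof -
  have [measurable]: "f \<in> borel_measurable borel" using assms by auto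
  show ?thesis
    by (rule integrable_mult_bounded[OF b _ norm_fourier_le]) measurable
qed

lemma multiplier_measurable [measurable]:
  assumes [measurable]: "f \<in> borel_measurable borel"
  shows "fourier_multiplier b f \<in> borel_measurable borel"
  unfolding fourier_multiplier_def by measurable

lemma multiplier_add:
  assumes f: "integrable lborel f" and g: "integrable lborel g"
  shows "fourier_multiplier b (\<lambda>x. f x + g x) x = fourier_multiplier b f x + fourier_multiplier b g x"
proof -
  have "fourier (\<lambda>x. f x + g x) y = fourier f y + fourier g y" for y
    unfolding fourier_def using f g by (simp add: distrib_left integrable_cis_mult)
  then show ?thesis
    unfolding fourier_multiplier_def inv_fourier_def
    using integrable_symbol_fourier[OF f] integrable_symbol_fourier[OF g]
    by (simp add: distrib_left integrable_cis_mult)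
qed

lemma norm_multiplier_le:
  assumes f: "integrable lborel f"
  shows "norm (fourier_multiplier b f x) \<le> B * (LINT x|lborel. norm (f x))"
proof -
  let ?I = "LINT x|lborel. norm (f x)" and ?h = "\<lambda>y. complex_of_real (b y) * fourier f y"
  have I: "0 \<le> ?I" by simp
  have "norm (fourier ?h (- x)) \<le> (LINT y|lborel. norm (?h y))"
    by (rule norm_fourier_le)
  also have "\<dots> \<le> (LINT y|lborel. \<bar>b y\<bar> * ?I)"
    using integrable_symbol_fourier[OF f] b
    by (intro integral_mono integrable_norm integrable_mult_left)
       (auto simp: norm_mult intro!: mult_left_mono norm_fourier_le)
  also have "\<dots> \<le> (2 * pi) ^ CARD('n) * B * ?I"
    using bB I by (simp add: mult_right_mono)
  finally have "norm (fourier ?h (- x)) \<le> (2 * pi) ^ CARD('n) * (B * ?I)" by (simp add: mult_ac)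
  moreover have "norm (fourier_multiplier b f x) = norm (fourier ?h (- x)) / (2 * pi) ^ CARD('n)"
    by (simp add: fourier_multiplier_def inv_fourier_eq norm_mult norm_divide norm_power)
  ultimately show ?thesis
    by (simp add: divide_le_eq mult_ac)
qed

text \<open>The Plancherel inequality is used on \<open>?h\<close> and again on \<open>f\<close>;
  its two factors \<open>?P\<close> cancel the squared normalisation of
  \<open>inv_fourier\<close>.\<close>

lemma nn_integral_multiplier_le:
  assumes f: "integrable lborel f"
  shows "(\<integral>\<^sup>+x. ennreal ((norm (fourier_multiplier b f x))\<^sup>2) \<partial>lborel) \<le>
    ennreal (A\<^sup>2) * (\<integral>\<^sup>+x. ennreal ((norm (f x))\<^sup>2) \<partial>lborel)"
proof -
  have [measurable]: "f \<in> borel_measurable borel" using f by auto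
  let ?P = "(2 * pi) ^ CARD('n)" and ?h = "\<lambda>y. complex_of_real (b y) * fourier f y"
  have P: "0 < ?P" by simp
  have "(\<integral>\<^sup>+x. ennreal ((norm (fourier_multiplier b f x))\<^sup>2) \<partial>lborel) =
     (\<integral>\<^sup>+x. ennreal (1 / ?P\<^sup>2) * ennreal ((norm (fourier ?h (- x)))\<^sup>2) \<partial>lborel)"
    by (simp add: fourier_multiplier_def inv_fourier_eq norm_mult norm_divide norm_power
        ennreal_mult[symmetric] power_divide)
  also have "\<dots> = ennreal (1 / ?P\<^sup>2) * (\<integral>\<^sup>+x. ennreal ((norm (fourier ?h (- x)))\<^sup>2) \<partial>lborel)"
    by (rule nn_integral_cmult) measurable
  also have "(\<integral>\<^sup>+x. ennreal ((norm (fourier ?h (- x)))\<^sup>2) \<partial>lborel) = (\<integral>\<^sup>+x. ennreal ((norm (fourier ?h x))\<^sup>2) \<partial>lborel)"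
    using nn_integral_lborel_affine[of "\<lambda>x. ennreal ((norm (fourier ?h x))\<^sup>2)" "-1" 0] by simp
  also have "\<dots> \<le> ennreal ?P * (\<integral>\<^sup>+x. ennreal ((norm (?h x))\<^sup>2) \<partial>lborel)"
    by (rule nn_integral_fourier_le[OF integrable_symbol_fourier[OF f]])
  also have "(\<integral>\<^sup>+x. ennreal ((norm (?h x))\<^sup>2) \<partial>lborel) \<le> (\<integral>\<^sup>+x. ennreal (A\<^sup>2) * ennreal ((norm (fourier f x))\<^sup>2) \<partial>lborel)"
  proof (rule nn_integral_mono)
    fix x
    have "(b x)\<^sup>2 \<le> A\<^sup>2" using bA[of x] A_nonneg by (simp add: abs_le_square_iff[symmetric])
    then show "ennreal ((norm (?h x))\<^sup>2) \<le> ennreal (A\<^sup>2) * ennreal ((norm (fourier f x))\<^sup>2)"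
      by (simp add: ennreal_mult[symmetric] norm_mult power_mult_distrib mult_right_mono ennreal_leI)
  qed
  also have "\<dots> = ennreal (A\<^sup>2) * (\<integral>\<^sup>+x. ennreal ((norm (fourier f x))\<^sup>2) \<partial>lborel)"
    by (rule nn_integral_cmult) measurable
  also have "(\<integral>\<^sup>+x. ennreal ((norm (fourier f x))\<^sup>2) \<partial>lborel) \<le> ennreal ?P * (\<integral>\<^sup>+x. ennreal ((norm (f x))\<^sup>2) \<partial>lborel)"
    by (rule nn_integral_fourier_le[OF f])
  finally have *: "(\<integral>\<^sup>+x. ennreal ((norm (fourier_multiplier b f x))\<^sup>2) \<partial>lborel) \<le>
     ennreal (1 / ?P\<^sup>2) * (ennreal ?P * (ennreal (A\<^sup>2) * (ennreal ?P * (\<integral>\<^sup>+x. ennreal ((norm (f x))\<^sup>2) \<partial>lborel))))"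
    by this (intro mult_left_mono; simp)+
  also have "\<dots> = ennreal (1 / ?P\<^sup>2 * ?P * ?P) * (ennreal (A\<^sup>2) * (\<integral>\<^sup>+x. ennreal ((norm (f x))\<^sup>2) \<partial>lborel))"
    using P by (simp only: ennreal_mult zero_le_divide_1_iff zero_le_power2 mult_nonneg_nonneg less_imp_le mult_ac)
  also have "1 / ?P\<^sup>2 * ?P * ?P = 1"
    by (simp add: power2_eq_square)
  finally show ?thesis by simp
qed

end

section \<open>Layer-cake integrals in the level \<open>l\<close>\<close>

lemma nn_integral_layer:
  fixes u p :: real
  assumes u: "0 \<le> u" and p: "2 < p"
  shows "(\<integral>\<^sup>+l. ennreal (indicator {0<..} l * l powr (p - 3) * (max 0 (u - l))\<^sup>2) \<partial>lborel) =
    ennreal (2 / (p * (p - 1) * (p - 2)) * u powr p)"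
proof -
  \<comment> \<open>The square is expanded and each power integrated from \<open>0\<close>, which
    converges because \<open>p > 2\<close>. The coefficients add up to the value of the Beta
    function at \<open>p - 2\<close> and \<open>3\<close>.\<close>
  have "((\<lambda>l. u\<^sup>2 * l powr (p - 3) - 2 * u * l powr (p - 2) + l powr (p - 1)) has_integral
    (u\<^sup>2 * (u powr (p - 3 + 1) / (p - 3 + 1)) - 2 * u * (u powr (p - 2 + 1) / (p - 2 + 1)) + u powr (p - 1 + 1) / (p - 1 + 1))) {0..u}"
    using p u by (intro has_integral_add has_integral_diff has_integral_mult_right has_integral_powr_from_0) auto
  also have "u\<^sup>2 * (u powr (p - 3 + 1) / (p - 3 + 1)) - 2 * u * (u powr (p - 2 + 1) / (p - 2 + 1)) + u powr (p - 1 + 1) / (p - 1 + 1)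
     = 2 / (p * (p - 1) * (p - 2)) * u powr p"
  proof (cases "u = 0")
    case False
    have "u\<^sup>2 * u powr (p - 2) = u powr p" "u * u powr (p - 1) = u powr p"
      using u False by (simp_all add: powr_diff power2_eq_square)
    then have "u\<^sup>2 * (u powr (p - 3 + 1) / (p - 3 + 1)) - 2 * u * (u powr (p - 2 + 1) / (p - 2 + 1)) + u powr (p - 1 + 1) / (p - 1 + 1)
      = u powr p * (1 / (p - 2) - 2 / (p - 1) + 1 / p)"
      by (simp add: algebra_simps)
    also have "1 / (p - 2) - 2 / (p - 1) + 1 / p = 2 / (p * (p - 1) * (p - 2))"
      using p by (simp add: divide_simps) (simp add: algebra_simps)
    finally show ?thesis by simp
  qed auto
  finally have "((\<lambda>l. l powr (p - 3) * (u - l)\<^sup>2) has_integral 2 / (p * (p - 1) * (p - 2)) * u powr p) {0..u}"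
  proof (rule has_integral_eq[rotated])
    fix l :: real assume l: "l \<in> {0..u}"
    show "u\<^sup>2 * l powr (p - 3) - 2 * u * l powr (p - 2) + l powr (p - 1) = l powr (p - 3) * (u - l)\<^sup>2"
    proof (cases "l = 0")
      case False
      then have "l powr (p - 2) = l powr (p - 3) * l" "l powr (p - 1) = l powr (p - 3) * l\<^sup>2"
        using l powr_add[of l "p - 3" 1] powr_add[of l "p - 3" 2] by auto
      then show ?thesis by (simp add: power2_eq_square algebra_simps)
    qed auto
  qed
  from nn_integral_has_integral_lebesgue[OF _ this]
  have "(\<integral>\<^sup>+l. ennreal (indicator {0..u} l * (l powr (p - 3) * (u - l)\<^sup>2)) \<partial>lborel) = ennreal (2 / (p * (p - 1) * (p - 2)) * u powr p)"
    by simp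
  moreover have "indicator {0<..} l * l powr (p - 3) * (max 0 (u - l))\<^sup>2 = indicator {0..u} l * (l powr (p - 3) * (u - l)\<^sup>2)" for l
    by (auto simp: indicator_def max_def)
  ultimately show ?thesis by (simp only:)
qed

text \<open>The inner integral once the order of integration has been exchanged: at a point with
  \<open>w = norm (f x) powr r\<close> the small part of \<open>f\<close> survives exactly for the
  positive levels \<open>l\<close> up to \<open>K / w\<close>.\<close>

lemma nn_integral_powr_cutoff:
  fixes w K p :: real
  assumes w: "0 < w" and K: "0 \<le> K" and p: "2 < p"
  shows "(\<integral>\<^sup>+l. ennreal (indicator {0<..} l * l powr (p - 3) * indicator {..K} (l * w)) \<partial>lborel) =
    ennreal ((K / w) powr (p - 2) / (p - 2))"
proof -
  have "((\<lambda>l. l powr (p - 3)) has_integral (K / w) powr (p - 3 + 1) / (p - 3 + 1)) {0..K / w}"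
    using assms by (intro has_integral_powr_from_0) auto
  from nn_integral_has_integral_lebesgue[OF _ this]
  have "(\<integral>\<^sup>+l. ennreal (indicator {0..K / w} l * l powr (p - 3)) \<partial>lborel) = ennreal ((K / w) powr (p - 2) / (p - 2))"
    by (simp add: algebra_simps)
  moreover have "indicator {0<..} l * l powr (p - 3) * indicator {..K} (l * w) = indicator {0..K / w} l * l powr (p - 3)" for l
    using w by (auto simp: indicator_def field_simps)
  ultimately show ?thesis by (simp only:)
qed

lemma cutoff_measurable:
  fixes f :: "'a::euclidean_space \<Rightarrow> complex" and K :: real
  assumes [measurable]: "f \<in> borel_measurable borel"
  shows "(\<lambda>(x, l). ennreal a * (ennreal ((norm (f x))\<^sup>2) *
    ennreal (indicator {0<..} l * l powr s * indicator {..K} (l * norm (f x) powr r))))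
    \<in> borel_measurable (lborel \<Otimes>\<^sub>M lborel)"
proof -
  have "(\<lambda>z. indicator {..K} (snd z * norm (f (fst z)) powr r) :: real) \<in> borel_measurable (lborel \<Otimes>\<^sub>M lborel)"
    by (rule measurable_compose[where g="\<lambda>t. indicator {..K} t :: real" and N=borel]) measurable
  then have "(\<lambda>z. indicator {..K} (snd z * norm (f (fst z)) powr r) :: real) \<in> borel_measurable (borel \<Otimes>\<^sub>M borel)"
    by (simp cong: measurable_cong_sets)
  then show ?thesis
    unfolding split_beta'
    by (intro borel_measurable_times_ennreal measurable_compose[OF _ measurable_ennreal] borel_measurable_times) measurable
qed

context bounded_multiplier begin

text \<open>
  Real interpolation with a constant that stays bounded as \<open>p \<rightarrow> 2\<close>: the layer-cake formula is
  applied to \<open>(\<bar>F\<bar> - l)\<^sub>+\<^sup>2\<close> rather than to a distribution function, so that its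
  normalising factor cancels the factor \<open>1 / (p - 2)\<close> from the integration in \<open>l\<close>.
\<close>

lemma nn_integral_multiplier_excess_le:
  assumes f: "integrable lborel f" and B: "B > 0" and l: "0 < l" and r: "0 < r"
    and N: "integrable lborel (\<lambda>x. norm (f x) powr (1 + r))" "(LINT x|lborel. norm (f x) powr (1 + r)) = N" "0 < N"
  shows "(\<integral>\<^sup>+x. ennreal ((max 0 (norm (fourier_multiplier b f x) - l))\<^sup>2) \<partial>lborel) \<le>
    ennreal (A\<^sup>2) * (\<integral>\<^sup>+x. ennreal ((norm (f x))\<^sup>2 * indicator {..B * N} (l * norm (f x) powr r)) \<partial>lborel)"
proof -
  have [measurable]: "f \<in> borel_measurable borel" using f by auto
  \<comment> \<open>Large values of \<open>f\<close>, relative to a threshold that depends on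
    \<open>l\<close>, go into \<open>f1\<close>. On them \<open>norm (f x)\<close> is at most
    \<open>l / (B * N) * norm (f x) powr (1 + r)\<close>, so the integral of
    \<open>norm (f1 x)\<close> is at most \<open>l / B\<close> and the image of \<open>f1\<close>
    never exceeds \<open>l\<close>. The excess over \<open>l\<close> can only come from
    \<open>f2\<close>, for which the \<open>L\<^sup>2\<close> bound is used.\<close>
  let ?s = "\<lambda>x. l * norm (f x) powr r \<le> B * N"
  define f1 where "f1 = (\<lambda>x. of_bool (\<not> ?s x) *\<^sub>R f x)"
  define f2 where "f2 = (\<lambda>x. of_bool (?s x) *\<^sub>R f x)"
  have [measurable]: "f1 \<in> borel_measurable borel" "f2 \<in> borel_measurable borel"
    unfolding f1_def f2_def by measurable
  have i1: "integrable lborel f1" and i2: "integrable lborel f2"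
    by (rule Bochner_Integration.integrable_bound[OF f]; simp add: f1_def f2_def)+
  have le1: "norm (f1 x) \<le> l / (B * N) * norm (f x) powr (1 + r)" for x
  proof (cases "f x = 0")
    case False
    have "norm (f x) * (B * N) \<le> norm (f x) * (l * norm (f x) powr r)" if "\<not> ?s x"
      using that by (intro mult_left_mono) auto
    then show ?thesis using False B N(3) l
      by (auto simp: f1_def powr_add field_simps)
  qed (simp add: f1_def)
  have "(LINT x|lborel. norm (f1 x)) \<le> (LINT x|lborel. l / (B * N) * norm (f x) powr (1 + r))"
    using N(1) i1 le1 by (intro integral_mono) auto
  also have "\<dots> = l / B" using N by simp
  finally have "B * (LINT x|lborel. norm (f1 x)) \<le> l" using B by (simp add: field_simps)
  then have T1: "norm (fourier_multiplier b f1 x) \<le> l" for x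
    using norm_multiplier_le[OF i1, of x] by linarith
  have "f = (\<lambda>x. f1 x + f2 x)" by (auto simp: f1_def f2_def)
  then have "norm (fourier_multiplier b f x) \<le> norm (fourier_multiplier b f1 x) + norm (fourier_multiplier b f2 x)" for x
    using multiplier_add[OF i1 i2, of x] norm_triangle_ineq by metis
  then have "max 0 (norm (fourier_multiplier b f x) - l) \<le> norm (fourier_multiplier b f2 x)" for x
    using T1[of x] by (smt (verit) norm_ge_zero)
  then have "(max 0 (norm (fourier_multiplier b f x) - l))\<^sup>2 \<le> (norm (fourier_multiplier b f2 x))\<^sup>2" for x
    by (intro power_mono) auto
  then have "(\<integral>\<^sup>+x. ennreal ((max 0 (norm (fourier_multiplier b f x) - l))\<^sup>2) \<partial>lborel) \<le>
     (\<integral>\<^sup>+x. ennreal ((norm (fourier_multiplier b f2 x))\<^sup>2) \<partial>lborel)"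
    by (intro nn_integral_mono ennreal_leI)
  also have "\<dots> \<le> ennreal (A\<^sup>2) * (\<integral>\<^sup>+x. ennreal ((norm (f2 x))\<^sup>2) \<partial>lborel)"
    by (rule nn_integral_multiplier_le[OF i2])
  also have "(\<lambda>x. (norm (f2 x))\<^sup>2) = (\<lambda>x. (norm (f x))\<^sup>2 * indicator {..B * N} (l * norm (f x) powr r))"
    by (auto simp: f2_def)
  finally show ?thesis .
qed

text \<open>Integrating the excess estimate against \<open>l powr (p - 3)\<close> and exchanging the
  order of integration turns the truncated square of \<open>norm (f x)\<close> into
  \<open>norm (f x) powr q\<close>. The factor \<open>N\<close> in the threshold is what yields the
  homogeneous power \<open>N powr (p - 1)\<close>.\<close>

lemma nn_integral_multiplier_powr_le:
  assumes f: "integrable lborel f" and B: "B > 0" and p: "2 < p" and q: "q = p / (p - 1)"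
    and N: "integrable lborel (\<lambda>x. norm (f x) powr q)" "(LINT x|lborel. norm (f x) powr q) = N"
  shows "(\<integral>\<^sup>+x. ennreal (norm (fourier_multiplier b f x) powr p) \<partial>lborel) \<le>
    ennreal (p * (p - 1) / 2 * A\<^sup>2 * B powr (p - 2) * N powr (p - 1))"
\<comment> \<open>The threshold needs \<open>N > 0\<close>. If \<open>N = 0\<close>, then
  \<open>f\<close> vanishes almost everywhere, and the \<open>L\<^sup>1\<close> bound makes the
  image vanish everywhere.\<close>
proof (cases "N = 0")
  case True
  have [measurable]: "f \<in> borel_measurable borel" using f by auto
  have "AE x in lborel. norm (f x) powr q = 0"
    using N True by (subst integral_nonneg_eq_0_iff_AE[symmetric]) auto
  then have "AE x in lborel. norm (f x) = 0" by eventually_elim (auto simp: powr_eq_0_iff)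
  then have "(LINT x|lborel. norm (f x)) = 0"
    by (rule integral_eq_zero_AE)
  then have "norm (fourier_multiplier b f x) = 0" for x
    using norm_multiplier_le[OF f, of x] by simp
  then show ?thesis by (simp add: powr_def)
next
  case False
  have "N \<ge> 0" unfolding N(2)[symmetric] by simp
  with False have N0: "N > 0" by simp
  have [measurable]: "f \<in> borel_measurable borel" using f by auto
  define r where "r = 1 / (p - 1)"
  have r: "r > 0" and q': "q = 1 + r" using p q by (auto simp: r_def field_simps)
  let ?F = "\<lambda>x. norm (fourier_multiplier b f x)"
  let ?c = "p * (p - 1) * (p - 2) / 2"
  have c: "0 < ?c" using p by simp
  have 1: "(\<integral>\<^sup>+x. ennreal (?F x powr p) \<partial>lborel) =
     (\<integral>\<^sup>+x. ennreal ?c * (\<integral>\<^sup>+l. ennreal (indicator {0<..} l * l powr (p - 3) * (max 0 (?F x - l))\<^sup>2) \<partial>lborel) \<partial>lborel)"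
  proof (rule nn_integral_cong)
    fix x
    show "ennreal (?F x powr p) = ennreal ?c * (\<integral>\<^sup>+l. ennreal (indicator {0<..} l * l powr (p - 3) * (max 0 (?F x - l))\<^sup>2) \<partial>lborel)"
      using p by (subst nn_integral_layer) (auto simp: ennreal_mult[symmetric] simp del: ennreal_mult)
  qed
  have 2: "(\<integral>\<^sup>+x. ennreal ?c * (\<integral>\<^sup>+l. ennreal (indicator {0<..} l * l powr (p - 3) * (max 0 (?F x - l))\<^sup>2) \<partial>lborel) \<partial>lborel) =
    ennreal ?c * (\<integral>\<^sup>+x. \<integral>\<^sup>+l. ennreal (indicator {0<..} l * l powr (p - 3) * (max 0 (?F x - l))\<^sup>2) \<partial>lborel \<partial>lborel)"
    by (rule nn_integral_cmult) measurable
  have "(\<integral>\<^sup>+x. \<integral>\<^sup>+l. ennreal (indicator {0<..} l * l powr (p - 3) * (max 0 (?F x - l))\<^sup>2) \<partial>lborel \<partial>lborel) =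
    (\<integral>\<^sup>+l. \<integral>\<^sup>+x. ennreal (indicator {0<..} l * l powr (p - 3) * (max 0 (?F x - l))\<^sup>2) \<partial>lborel \<partial>lborel)"
    by (rule lborel_pair.Fubini'[symmetric]) measurable
  also have "\<dots> \<le> (\<integral>\<^sup>+l. \<integral>\<^sup>+x. ennreal (A\<^sup>2) * (ennreal ((norm (f x))\<^sup>2) * ennreal (indicator {0<..} l * l powr (p - 3) * indicator {..B * N} (l * norm (f x) powr r))) \<partial>lborel \<partial>lborel)"
  proof (rule nn_integral_mono)
    fix l :: real
    show "(\<integral>\<^sup>+x. ennreal (indicator {0<..} l * l powr (p - 3) * (max 0 (?F x - l))\<^sup>2) \<partial>lborel)
      \<le> (\<integral>\<^sup>+x. ennreal (A\<^sup>2) * (ennreal ((norm (f x))\<^sup>2) * ennreal (indicator {0<..} l * l powr (p - 3) * indicator {..B * N} (l * norm (f x) powr r))) \<partial>lborel)"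
    proof (cases "l > 0")
      case True
      have "(\<integral>\<^sup>+x. ennreal (indicator {0<..} l * l powr (p - 3) * (max 0 (?F x - l))\<^sup>2) \<partial>lborel)
        = ennreal (l powr (p - 3)) * (\<integral>\<^sup>+x. ennreal ((max 0 (?F x - l))\<^sup>2) \<partial>lborel)"
        using True by (subst nn_integral_cmult[symmetric]) (auto simp: ennreal_mult[symmetric])
      also have "\<dots> \<le> ennreal (l powr (p - 3)) * (ennreal (A\<^sup>2) * (\<integral>\<^sup>+x. ennreal ((norm (f x))\<^sup>2 * indicator {..B * N} (l * norm (f x) powr r)) \<partial>lborel))"
        using N N0 unfolding q'
        by (intro mult_left_mono nn_integral_multiplier_excess_le[OF f B True r]) auto
      also have "\<dots> = (\<integral>\<^sup>+x. ennreal (l powr (p - 3)) * (ennreal (A\<^sup>2) * ennreal ((norm (f x))\<^sup>2 * indicator {..B * N} (l * norm (f x) powr r))) \<partial>lborel)"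
        by (simp add: nn_integral_cmult)
      also have "\<dots> = (\<integral>\<^sup>+x. ennreal (A\<^sup>2) * (ennreal ((norm (f x))\<^sup>2) * ennreal (indicator {0<..} l * l powr (p - 3) * indicator {..B * N} (l * norm (f x) powr r))) \<partial>lborel)"
        using True by (intro nn_integral_cong) (simp add: ennreal_mult[symmetric] mult_ac)
      finally show ?thesis .
    qed simp
  qed
  also have "\<dots> = (\<integral>\<^sup>+x. \<integral>\<^sup>+l. ennreal (A\<^sup>2) * (ennreal ((norm (f x))\<^sup>2) * ennreal (indicator {0<..} l * l powr (p - 3) * indicator {..B * N} (l * norm (f x) powr r))) \<partial>lborel \<partial>lborel)"
    by (rule lborel_pair.Fubini'[OF cutoff_measurable]) measurable
  also have "\<dots> = (\<integral>\<^sup>+x. ennreal (A\<^sup>2 * (B * N) powr (p - 2) / (p - 2)) * ennreal (norm (f x) powr q) \<partial>lborel)"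
  proof (rule nn_integral_cong)
    fix x
    have "(\<integral>\<^sup>+l. ennreal (A\<^sup>2) * (ennreal ((norm (f x))\<^sup>2) * ennreal (indicator {0<..} l * l powr (p - 3) * indicator {..B * N} (l * norm (f x) powr r))) \<partial>lborel)
      = ennreal (A\<^sup>2) * (ennreal ((norm (f x))\<^sup>2) * (\<integral>\<^sup>+l. ennreal (indicator {0<..} l * l powr (p - 3) * indicator {..B * N} (l * norm (f x) powr r)) \<partial>lborel))"
      by (simp add: nn_integral_cmult)
    also have "\<dots> = ennreal (A\<^sup>2 * (B * N) powr (p - 2) / (p - 2)) * ennreal (norm (f x) powr q)"
    proof (cases "f x = 0")
      case False
      \<comment> \<open>This identity dictates the truncation exponent \<open>r = q - 1\<close>: the
        cutoff integral contributes the power \<open>- r * (p - 2)\<close> of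
        \<open>norm (f x)\<close>, which lowers the exponent from \<open>2\<close> to
        \<open>q\<close>.\<close>
      have "r * (p - 2) + q = 2"
      proof -
        have "r * (p - 2) + q = 2 * (p - 1) / (p - 1)"
          unfolding r_def q by (simp flip: add_divide_distrib)
        also have "\<dots> = 2" using p by (intro nonzero_mult_div_cancel_right) auto
        finally show ?thesis .
      qed
      then have "norm (f x) powr (r * (p - 2)) * norm (f x) powr q = (norm (f x))\<^sup>2"
        using False by (simp flip: powr_add)
      then have "(norm (f x))\<^sup>2 * ((B * N / norm (f x) powr r) powr (p - 2) / (p - 2)) = (B * N) powr (p - 2) / (p - 2) * norm (f x) powr q"
      proof -
        have *: "P \<noteq> 0 \<Longrightarrow> P * Q * (X / P / D) = X / D * Q" for P Q X D :: real
          by simp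
        have "(B * N / norm (f x) powr r) powr (p - 2) = (B * N) powr (p - 2) / norm (f x) powr (r * (p - 2))"
          using B N0 by (simp add: powr_divide powr_powr)
        then show ?thesis
          unfolding \<open>_ = (norm (f x))\<^sup>2\<close>[symmetric] using False by (simp only:) (rule *, simp)
      qed
      then show ?thesis
        using False p B N0
        by (subst nn_integral_powr_cutoff) (auto simp: ennreal_mult[symmetric] mult_ac simp del: ennreal_mult)
    qed (simp add: powr_def)
    finally show "(\<integral>\<^sup>+l. ennreal (A\<^sup>2) * (ennreal ((norm (f x))\<^sup>2) * ennreal (indicator {0<..} l * l powr (p - 3) * indicator {..B * N} (l * norm (f x) powr r))) \<partial>lborel)
      = ennreal (A\<^sup>2 * (B * N) powr (p - 2) / (p - 2)) * ennreal (norm (f x) powr q)" .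
  qed
  also have "\<dots> = ennreal (A\<^sup>2 * (B * N) powr (p - 2) / (p - 2)) * ennreal N"
    using N by (subst nn_integral_cmult) (auto simp: nn_integral_eq_integral)
  finally have 3: "(\<integral>\<^sup>+x. \<integral>\<^sup>+l. ennreal (indicator {0<..} l * l powr (p - 3) * (max 0 (?F x - l))\<^sup>2) \<partial>lborel \<partial>lborel)
    \<le> ennreal (A\<^sup>2 * (B * N) powr (p - 2) / (p - 2)) * ennreal N" .
  have "(\<integral>\<^sup>+x. ennreal (?F x powr p) \<partial>lborel) \<le> ennreal ?c * (ennreal (A\<^sup>2 * (B * N) powr (p - 2) / (p - 2)) * ennreal N)"
    unfolding 1 2 by (rule mult_left_mono[OF 3]) simp
  also have "\<dots> = ennreal (?c * (A\<^sup>2 * (B * N) powr (p - 2) / (p - 2) * N))"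
    using p N0 c by (simp only: ennreal_mult[symmetric] less_imp_le mult_nonneg_nonneg divide_nonneg_pos zero_le_power2 powr_ge_zero diff_gt_0_iff_gt)
  also have "?c * (A\<^sup>2 * (B * N) powr (p - 2) / (p - 2) * N) = p * (p - 1) / 2 * A\<^sup>2 * B powr (p - 2) * (N powr (p - 2) * N)"
    using p B N0 by (simp add: powr_mult field_simps)
  also have "N powr (p - 2) * N = N powr (p - 1)"
    using N0 powr_add[of N "p - 2" 1] by simp
  finally show ?thesis .
qed

text \<open>At \<open>p = 2\<close> the weight \<open>l powr (p - 3)\<close> is not integrable near
  \<open>0\<close>, so this exponent is taken directly from the \<open>L\<^sup>2\<close> bound. The
  general formula has the value \<open>A\<^sup>2 * N\<close> there, which is what that bound
  gives.\<close>

lemma nn_integral_multiplier_powr_le':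
  assumes f: "integrable lborel f" and B: "B > 0" and p: "2 \<le> p" and q: "q = p / (p - 1)"
    and N: "integrable lborel (\<lambda>x. norm (f x) powr q)" "(LINT x|lborel. norm (f x) powr q) = N"
  shows "(\<integral>\<^sup>+x. ennreal (norm (fourier_multiplier b f x) powr p) \<partial>lborel) \<le>
    ennreal (p * (p - 1) / 2 * A\<^sup>2 * B powr (p - 2) * N powr (p - 1))"
proof (cases "p = 2")
  case True
  have [simp]: "q = 2" using q True by simp
  have "N \<ge> 0" unfolding N(2)[symmetric] by simp
  have sq: "norm z powr 2 = (norm z)\<^sup>2" for z :: complex
    by (simp add: powr_numeral)
  have "(\<integral>\<^sup>+x. ennreal ((norm (fourier_multiplier b f x))\<^sup>2) \<partial>lborel) \<le> ennreal (A\<^sup>2) * (\<integral>\<^sup>+x. ennreal ((norm (f x))\<^sup>2) \<partial>lborel)"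
    by (rule nn_integral_multiplier_le[OF f])
  also have "(\<integral>\<^sup>+x. ennreal ((norm (f x))\<^sup>2) \<partial>lborel) = ennreal N"
    using N by (subst nn_integral_eq_integral) (simp_all add: sq)
  finally show ?thesis
    using True B \<open>N \<ge> 0\<close> by (simp add: sq ennreal_mult)
next
  case False
  with p have "2 < p" by simp
  then show ?thesis by (rule nn_integral_multiplier_powr_le[OF f B _ q N])
qed

section \<open>Passage from integrals to \<open>Lp_norm\<close>\<close>

lemma Lp_norm_multiplier_infinity_le:
  assumes f: "integrable lborel f" and B: "B > 0"
  shows "Lp_norm \<infinity> (fourier_multiplier b f) \<le> ennreal B * Lp_norm 1 f"
proof -
  have [measurable]: "f \<in> borel_measurable borel" using f by auto
  have I: "(\<integral>\<^sup>+x. ennreal (norm (f x)) \<partial>lborel) = ennreal (LINT x|lborel. norm (f x))"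
    using f by (intro nn_integral_eq_integral) auto
  have "Lp_norm \<infinity> (fourier_multiplier b f) \<le> ennreal (B * (LINT x|lborel. norm (f x)))"
    unfolding Lp_norm_def by (auto intro!: AE_I2 ennreal_leI norm_multiplier_le[OF f])
  also have "\<dots> = ennreal B * Lp_norm 1 f"
    using B I by (simp add: Lp_norm_def Let_def ennreal_mult)
  finally show ?thesis .
qed

lemma Lp_norm_multiplier_finite_le:
  assumes f: "integrable lborel f" and A: "A > 0" and B: "B > 0" and p: "2 \<le> p" and q: "q = p / (p - 1)"
  shows "Lp_norm (ennreal p) (fourier_multiplier b f) \<le>
    ennreal (exp 1 * A powr (2 / p) * B powr (1 - 2 / p)) * Lp_norm (ennreal q) f"
proof -
  have [measurable]: "f \<in> borel_measurable borel" using f by auto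
  have q0: "q > 0" using p q by simp
  let ?I = "\<integral>\<^sup>+x. ennreal (norm (f x) powr q) \<partial>lborel"
  let ?J = "\<integral>\<^sup>+x. ennreal (norm (fourier_multiplier b f x) powr p) \<partial>lborel"
  let ?k = "exp 1 * A powr (2 / p) * B powr (1 - 2 / p)"
  have k: "0 < ?k" using A B by simp
  have Lq: "Lp_norm (ennreal q) f = (if ?I = \<infinity> then \<infinity> else ennreal (enn2real ?I powr (1 / q)))"
    using q0 by (simp add: Lp_norm_def Let_def)
  have Lp: "Lp_norm (ennreal p) (fourier_multiplier b f) = (if ?J = \<infinity> then \<infinity> else ennreal (enn2real ?J powr (1 / p)))"
    using p by (simp add: Lp_norm_def Let_def)
  show ?thesis
  proof (cases "?I = \<infinity>")
    case True
    then show ?thesis using A B unfolding Lq by (simp add: ennreal_mult_top)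
  next
    case False
    define N where "N = (LINT x|lborel. norm (f x) powr q)"
    have int: "integrable lborel (\<lambda>x. norm (f x) powr q)"
      using False by (simp add: integrable_iff_bounded less_top)
    have N: "0 \<le> N" by (simp add: N_def)
    have IN: "?I = ennreal N"
      unfolding N_def by (rule nn_integral_eq_integral[OF int]) simp
    let ?M = "p * (p - 1) / 2 * A\<^sup>2 * B powr (p - 2) * N powr (p - 1)"
    have M: "0 \<le> ?M" using p by simp
    have J: "?J \<le> ennreal ?M"
      using nn_integral_multiplier_powr_le'[OF f B p q int] by (simp add: N_def)
    then have "?J \<noteq> \<infinity>" by (auto simp: top_unique)
    have "enn2real ?J \<le> ?M"
      using J M by (intro enn2real_leI) auto
    then have "enn2real ?J powr (1 / p) \<le> ?M powr (1 / p)"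
      using p by (intro powr_mono2) auto
    \<comment> \<open>The quadratic polynomial in \<open>p\<close> is traded for
      \<open>exp p\<close>, whose p-th root is \<open>exp 1\<close>; this is how the constant
      becomes independent of \<open>p\<close>.\<close>
    also have "\<dots> \<le> (exp p * (A\<^sup>2 * B powr (p - 2) * N powr (p - 1))) powr (1 / p)"
    proof (rule powr_mono2)
      have "p * (p - 1) / 2 \<le> exp p"
        using exp_lower_Taylor_quadratic[of p] p by (simp add: power2_eq_square algebra_simps)
      then have "p * (p - 1) / 2 * (A\<^sup>2 * B powr (p - 2) * N powr (p - 1)) \<le> exp p * (A\<^sup>2 * B powr (p - 2) * N powr (p - 1))"
        by (rule mult_right_mono) simp
      then show "?M \<le> exp p * (A\<^sup>2 * B powr (p - 2) * N powr (p - 1))" by (simp add: mult_ac)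
    qed (use p M in auto)
    also have "\<dots> = exp 1 * (A powr (2 / p) * B powr ((p - 2) / p) * N powr ((p - 1) / p))"
    proof -
      have "exp p powr (1 / p) = exp 1" using p by (simp add: powr_def)
      moreover have "A\<^sup>2 powr (1 / p) = A powr (2 / p)"
        using A by (simp add: powr_powr flip: powr_numeral)
      ultimately show ?thesis
        using A B N p by (simp add: powr_mult powr_powr)
    qed
    also have "(p - 2) / p = 1 - 2 / p" using p by (simp add: diff_divide_distrib)
    also have "(p - 1) / p = 1 / q" using q by simp
    finally have "enn2real ?J powr (1 / p) \<le> ?k * N powr (1 / q)" by (simp add: mult_ac)
    then have "ennreal (enn2real ?J powr (1 / p)) \<le> ennreal (?k * N powr (1 / q))"
      by (rule ennreal_leI)
    also have "\<dots> = ennreal ?k * ennreal (N powr (1 / q))"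
      using k by (intro ennreal_mult) auto
    finally show ?thesis
      unfolding Lp Lq using False \<open>?J \<noteq> \<infinity>\<close> IN N by simp
  qed
qed

text \<open>The conjugacy relation lives in \<open>ennreal\<close>, where
  \<open>1 / \<infinity> = 0\<close> and \<open>1 / 0 = \<infinity>\<close>. With
  \<open>2 \<le> p\<close> it excludes \<open>q = 0\<close> and \<open>q = \<infinity>\<close>, and
  \<open>p = \<infinity>\<close> forces \<open>q = 1\<close>, so real exponents can be
  extracted.\<close>

lemma Lp_norm_multiplier_le:
  fixes p q :: ennreal
  assumes f: "integrable lborel f" and A: "A > 0" and B: "B > 0"
    and p: "2 \<le> p" and pq: "1 / p + 1 / q = 1"
  shows "Lp_norm p (fourier_multiplier b f) \<le>
    ennreal (exp 1 * A powr (2 * enn2real (1 / p)) * B powr (1 - 2 * enn2real (1 / p))) * Lp_norm q f"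
proof (cases "p = \<infinity>")
  case True
  have q0: "q \<noteq> 0" and qtop: "q \<noteq> \<infinity>" using pq True by auto
  then obtain r where r: "q = ennreal r" "0 < r"
    by (cases q) (auto simp: ennreal_eq_0_iff order.order_iff_strict)
  have "1 / q = ennreal (1 / r)" using r divide_ennreal[of 1 r] by simp
  then have "q = 1" using pq True r by (simp add: ennreal_eq_1)
  have "Lp_norm p (fourier_multiplier b f) \<le> ennreal B * Lp_norm q f"
    using Lp_norm_multiplier_infinity_le[OF f B] True \<open>q = 1\<close> by simp
  \<comment> \<open>The factor \<open>exp 1\<close> gives the endpoint the same form as the bound at
    finite exponents.\<close>
  also have "\<dots> \<le> ennreal (exp 1 * B) * Lp_norm q f"
    using B by (intro mult_right_mono ennreal_leI) auto
  finally show ?thesis using True A B by simp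
next
  case False
  then obtain P where P: "p = ennreal P" "0 \<le> P" by (cases p) auto
  have P2: "2 \<le> P" using p P ennreal_le_iff[of P 2] by simp
  have ip: "1 / p = ennreal (1 / P)" using P P2 divide_ennreal[of 1 P] by simp
  have "1 / p \<noteq> 1" using P2 by (simp add: ip ennreal_eq_1)
  then have qtop: "q \<noteq> \<infinity>" using pq by auto
  have "q \<noteq> 0" using pq by auto
  with qtop obtain Q where Q: "q = ennreal Q" "0 < Q"
    by (cases q) (auto simp: order.order_iff_strict)
  have iq: "1 / q = ennreal (1 / Q)" using Q divide_ennreal[of 1 Q] by simp
  have "ennreal (1 / P + 1 / Q) = 1"
    using pq P2 Q unfolding ip iq by (subst ennreal_plus) auto
  then have "1 / P + 1 / Q = 1" by (simp add: ennreal_eq_1)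
  then have "Q = P / (P - 1)" using P2 Q by (simp add: field_simps)
  moreover have "enn2real (1 / p) = 1 / P" using P2 by (simp add: ip)
  ultimately show ?thesis
    using Lp_norm_multiplier_finite_le[OF f A B P2] P Q by simp
qed

end

section \<open>Decay of the weighted symbol\<close>

lemma integrable_Japanese_real:
  fixes a :: real
  assumes a: "a > 1"
  shows "integrable lborel (\<lambda>x::real. (1 + x\<^sup>2) powr (- a / 2))"
proof (rule Bochner_Integration.integrable_bound)
  let ?g = "\<lambda>x::real. indicator {1..} x * x powr (- a)"
  have "((\<lambda>x. x powr (- a)) has_integral - (1 powr (- a + 1)) / (- a + 1)) {1..}"
    using a by (intro has_integral_powr_to_inf) auto
  from nn_integral_has_integral_lebesgue[OF _ this]
  have g: "integrable lborel ?g"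
    by (intro integrableI_nonneg) auto
  then have g': "integrable lborel (\<lambda>x. ?g (0 + (-1) * x))"
    by (intro lborel_integrable_real_affine) auto
  have i: "integrable lborel (indicator {-1..1::real} :: real \<Rightarrow> real)"
    by simp
  show "integrable lborel (\<lambda>x. indicator {-1..1} x + ?g x + ?g (0 + (-1) * x))"
    by (intro Bochner_Integration.integrable_add i g g')
  have le: "(1 + x\<^sup>2) powr (- a / 2) \<le> x powr (- a)" if "x \<ge> 1" for x :: real
  proof -
    have "(1 + x\<^sup>2) powr (- a / 2) \<le> (x\<^sup>2) powr (- a / 2)"
      using that a by (intro powr_mono2') auto
    also have "\<dots> = x powr (- a)"
      using that by (simp add: powr_powr flip: powr_numeral)
    finally show ?thesis .
  qed
  have le1: "(1 + x\<^sup>2) powr (- a / 2) \<le> 1" for x :: real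
    using a powr_mono2'[of "- a / 2" 1 "1 + x\<^sup>2"] by simp
  have "(1 + x\<^sup>2) powr (- a / 2) \<le> indicator {-1..1} x + ?g x + ?g (0 + (-1) * x)" for x :: real
    using le[of x] le[of "- x"] le1[of x] by (auto simp: indicator_def)
  then show "AE x in lborel. norm ((1 + x\<^sup>2) powr (- a / 2)) \<le> norm (indicator {-1..1} x + ?g x + ?g (0 + (-1) * x))"
    by (intro AE_I2) (smt (verit) real_norm_def powr_ge_zero)
qed auto

text \<open>Splitting the exponent evenly among the coordinates bounds the weight by a product of
  one-dimensional weights, each with exponent \<open>s / ?n > 1\<close>. This replaces polar
  coordinates.\<close>

lemma integrable_Japanese:
  assumes s: "s > real DIM('a::euclidean_space)"
  shows "integrable lborel (\<lambda>x::'a. (1 + (norm x)\<^sup>2) powr (- s / 2))"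
proof (rule Bochner_Integration.integrable_bound)
  let ?n = "real DIM('a)"
  let ?e = "- (s / ?n) / 2"
  have n: "?n > 0" by simp
  show "integrable lborel (\<lambda>x::'a. \<Prod>b\<in>Basis. (1 + (x \<bullet> b)\<^sup>2) powr ?e)"
    using s n by (intro integrable_lborel_prod integrable_Japanese_real) (simp add: field_simps)
  have le: "(1 + (norm x)\<^sup>2) powr (- s / 2) \<le> (\<Prod>b\<in>Basis. (1 + (x \<bullet> b)\<^sup>2) powr ?e)" for x :: 'a
  proof -
    have "(1 + (norm x)\<^sup>2) powr (- s / 2) = ((1 + (norm x)\<^sup>2) powr ?e) powr ?n"
      by (simp add: powr_powr)
    also have "\<dots> = ((1 + (norm x)\<^sup>2) powr ?e) ^ DIM('a)"
      by (rule powr_realpow) (smt (verit) powr_gt_zero zero_le_power2)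
    also have "\<dots> = (\<Prod>b\<in>(Basis::'a set). (1 + (norm x)\<^sup>2) powr ?e)" by simp
    also have "\<dots> \<le> (\<Prod>b\<in>Basis. (1 + (x \<bullet> b)\<^sup>2) powr ?e)"
    proof (intro prod_mono conjI powr_mono2')
      fix b :: 'a assume "b \<in> Basis"
      then have "\<bar>x \<bullet> b\<bar> \<le> norm x" by (rule Basis_le_norm)
      then show "1 + (x \<bullet> b)\<^sup>2 \<le> 1 + (norm x)\<^sup>2" using abs_le_square_iff[of "x \<bullet> b" "norm x"] by simp
      show "?e \<le> 0" using s n by (simp add: divide_nonneg_pos)
    qed (auto intro: add_pos_nonneg)
    finally show ?thesis .
  qed
  show "AE x::'a in lborel. norm ((1 + (norm x)\<^sup>2) powr (- s / 2)) \<le> norm (\<Prod>b\<in>Basis. (1 + (x \<bullet> b)\<^sup>2) powr ?e)"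
    unfolding real_norm_def abs_of_nonneg[OF powr_ge_zero]
    by (intro AE_I2 order_trans[OF le abs_ge_self])
qed auto

text \<open>This is \<open>u \<le> exp u\<close> at \<open>u = c * t / a\<close>, raised to the
  power \<open>a\<close>. It turns the exponential decay at high frequencies into the required power
  of \<open>t\<close>, for small and large \<open>t\<close> alike.\<close>

lemma powr_exp_neg_le:
  fixes t a c :: real
  assumes "t > 0" "a > 0" "c > 0"
  shows "exp (- c * t) \<le> (a / c) powr a * t powr (- a)"
proof -
  have "c * t / a \<le> exp (c * t / a)"
    using exp_ge_add_one_self[of "c * t / a"] by linarith
  then have "(c * t / a) powr a \<le> exp (c * t / a) powr a"
    using assms by (intro powr_mono2) auto
  also have "\<dots> = exp (c * t)" using assms by (simp add: powr_def)
  finally have "(c * t / a) powr a * exp (- c * t) \<le> exp (c * t) * exp (- c * t)"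
    by (rule mult_right_mono) simp
  also have "\<dots> = 1" by (simp flip: exp_add)
  finally have "(a / c) powr a * t powr (- a) * ((c * t / a) powr a * exp (- c * t)) \<le> (a / c) powr a * t powr (- a) * 1"
    by (rule mult_left_mono) simp
  moreover have "(a / c) powr a * t powr (- a) * (c * t / a) powr a = 1"
    using assms by (simp add: powr_divide powr_mult powr_minus field_simps)
  ultimately show ?thesis by (simp add: mult.assoc[symmetric])
qed

text \<open>Up to the factor 3, the common majorant of all symbols to be estimated, with
  \<open>s = 1 - \<sigma>\<close>. The exponential is the modulus of the oscillating part of the
  evolution.\<close>

definition damped_weight :: "real \<Rightarrow> real \<Rightarrow> 'a::euclidean_space \<Rightarrow> real" where
  "damped_weight s t y = (1 + (norm y)\<^sup>2) powr (- s / 2) * exp (- ((norm y)\<^sup>2 * t / (2 * (1 + (norm y)\<^sup>2))))"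

lemma damped_weight_pos: "0 < damped_weight s t y"
  unfolding damped_weight_def by (smt (verit) exp_gt_zero mult_pos_pos powr_gt_zero zero_le_power2)

lemma damped_weight_measurable [measurable]: "damped_weight s t \<in> borel_measurable borel"
  unfolding damped_weight_def[abs_def] by measurable

lemma damped_weight_le_1:
  assumes "0 \<le> s" "0 \<le> t"
  shows "damped_weight s t y \<le> 1"
proof -
  have "(1 + (norm y)\<^sup>2) powr (- s / 2) \<le> 1"
    using assms powr_mono2'[of "- s / 2" 1 "1 + (norm y)\<^sup>2"] by simp
  moreover have "exp (- ((norm y)\<^sup>2 * t / (2 * (1 + (norm y)\<^sup>2)))) \<le> 1"
    using assms by (simp add: divide_nonneg_pos add_pos_nonneg)
  ultimately show ?thesis
    unfolding damped_weight_def by (intro mult_le_one) auto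
qed

text \<open>The exponent is at least \<open>\<bar>y\<bar>\<^sup>2 t / 4\<close> for \<open>\<bar>y\<bar> \<le> 1\<close> and at least \<open>t / 4\<close> otherwise.\<close>

lemma damped_weight_le:
  assumes s: "0 \<le> s" and t: "0 < t"
  shows "damped_weight s t y \<le> gauss (sqrt (t / 2)) y + (1 + (norm y)\<^sup>2) powr (- s / 2) * exp (- (1 / 4) * t)"
proof (cases "norm y \<le> 1")
  case True
  then have y1: "(norm y)\<^sup>2 \<le> 1" by (simp add: power_le_one)
  have "(norm y)\<^sup>2 * t / 4 \<le> (norm y)\<^sup>2 * t / (2 * (1 + (norm y)\<^sup>2))"
    using y1 t by (intro divide_left_mono) (auto intro!: mult_pos_pos add_pos_nonneg)
  then have "exp (- ((norm y)\<^sup>2 * t / (2 * (1 + (norm y)\<^sup>2)))) \<le> gauss (sqrt (t / 2)) y"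
    using t by (simp add: gauss_def power_mult_distrib mult.commute)
  moreover have "(1 + (norm y)\<^sup>2) powr (- s / 2) \<le> 1"
    using s powr_mono2'[of "- s / 2" 1 "1 + (norm y)\<^sup>2"] by simp
  ultimately have "damped_weight s t y \<le> 1 * gauss (sqrt (t / 2)) y"
    unfolding damped_weight_def by (intro mult_mono) auto
  also have "\<dots> \<le> gauss (sqrt (t / 2)) y + (1 + (norm y)\<^sup>2) powr (- s / 2) * exp (- (1 / 4) * t)"
    by simp
  finally show ?thesis .
next
  case False
  then have y1: "(norm y)\<^sup>2 \<ge> 1" by (simp add: one_le_power)
  have "1 / 4 * t \<le> (norm y)\<^sup>2 * t / (2 * (1 + (norm y)\<^sup>2))"
    using y1 t by (simp add: field_simps)
  then have "exp (- ((norm y)\<^sup>2 * t / (2 * (1 + (norm y)\<^sup>2)))) \<le> exp (- (1 / 4) * t)"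
    by simp
  then have "damped_weight s t y \<le> (1 + (norm y)\<^sup>2) powr (- s / 2) * exp (- (1 / 4) * t)"
    unfolding damped_weight_def by (intro mult_left_mono) auto
  also have "\<dots> \<le> gauss (sqrt (t / 2)) y + (1 + (norm y)\<^sup>2) powr (- s / 2) * exp (- (1 / 4) * t)"
    by simp
  finally show ?thesis .
qed

lemma integral_damped_weight_le:
  assumes s: "s > real CARD('n::finite)"
  shows "\<exists>K>0. \<forall>t>0. integrable lborel (damped_weight s t :: real^'n \<Rightarrow> real) \<and>
     (LINT y|lborel. damped_weight s t (y :: real^'n)) \<le> K * t powr (- real CARD('n) / 2)"
proof -
  let ?n = "real CARD('n)"
  have n: "?n > 0" by simp
  have w: "integrable lborel (\<lambda>y::real^'n. (1 + (norm y)\<^sup>2) powr (- s / 2))"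
    using s by (intro integrable_Japanese) simp
  define W where "W = (LINT y|lborel. (1 + (norm (y::real^'n))\<^sup>2) powr (- s / 2))"
  have W: "0 \<le> W" unfolding W_def by simp
  \<comment> \<open>The first summand is the constant in the mass
    \<open>(4 * pi / t) powr (?n / 2)\<close> of the Gaussian; the second is the decay of
    \<open>exp (- t / 4)\<close> measured against \<open>t powr (- ?n / 2)\<close>, that is
    \<open>a = ?n / 2\<close> and \<open>c = 1 / 4\<close> in
    \<open>powr_exp_neg_le\<close>.\<close>
  define K where "K = (4 * pi) powr (?n / 2) + W * (?n / 2 / (1 / 4)) powr (?n / 2)"
  have K: "0 < K" unfolding K_def using W by (intro add_pos_nonneg) auto
  have "integrable lborel (damped_weight s t :: real^'n \<Rightarrow> real) \<and>
     (LINT y|lborel. damped_weight s t (y :: real^'n)) \<le> K * t powr (- ?n / 2)" if t: "t > 0" for t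
  proof -
    let ?g = "\<lambda>y::real^'n. gauss (sqrt (t / 2)) y + (1 + (norm y)\<^sup>2) powr (- s / 2) * exp (- (1 / 4) * t)"
    have g1: "integrable lborel (gauss (sqrt (t / 2)) :: real^'n \<Rightarrow> real)"
      using t by (intro integrable_gauss) simp
    have g: "integrable lborel ?g"
      using g1 w by auto
    have le: "damped_weight s t y \<le> ?g y" for y
      using s n t by (intro damped_weight_le) auto
    have int: "integrable lborel (damped_weight s t :: real^'n \<Rightarrow> real)"
    proof (rule Bochner_Integration.integrable_bound[OF g])
      show "AE y::real^'n in lborel. norm (damped_weight s t y) \<le> norm (?g y)"
        unfolding real_norm_def abs_of_pos[OF damped_weight_pos]
        by (intro AE_I2 order_trans[OF le abs_ge_self])
    qed auto
    have "(LINT y|lborel. damped_weight s t (y :: real^'n)) \<le> (LINT y|lborel. ?g y)"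
      by (intro integral_mono int g le)
    also have "\<dots> = (sqrt (2 * pi) / sqrt (t / 2)) ^ CARD('n) + W * exp (- (1 / 4) * t)"
      using g1 w t integral_gauss[where 'n='n, of "sqrt (t / 2)"] by (simp add: W_def)
    also have "(sqrt (2 * pi) / sqrt (t / 2)) ^ CARD('n) = (4 * pi) powr (?n / 2) * t powr (- ?n / 2)"
    proof -
      have "sqrt (2 * pi) / sqrt (t / 2) = sqrt (4 * pi / t)"
        by (simp flip: real_sqrt_divide)
      then have "(sqrt (2 * pi) / sqrt (t / 2)) ^ CARD('n) = sqrt (4 * pi / t) powr ?n"
        using t by (simp only:) (intro powr_realpow[symmetric], simp)
      also have "\<dots> = (4 * pi / t) powr (?n / 2)"
        using t by (simp add: powr_powr flip: powr_half_sqrt)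
      also have "\<dots> = (4 * pi) powr (?n / 2) * t powr (- ?n / 2)"
        using t by (simp add: powr_divide powr_minus_divide)
      finally show ?thesis .
    qed
    also have "W * exp (- (1 / 4) * t) \<le> W * ((?n / 2 / (1 / 4)) powr (?n / 2) * t powr (- (?n / 2)))"
      using t n W by (intro mult_left_mono powr_exp_neg_le) auto
    finally have "(LINT y|lborel. damped_weight s t (y :: real^'n)) \<le> K * t powr (- ?n / 2)"
      by (simp add: K_def algebra_simps)
    with int show ?thesis by simp
  qed
  with K show ?thesis by blast
qed

section \<open>Schwartz functions\<close>

lemma schwartz_differentiable: "f \<in> schwartz \<Longrightarrow> f differentiable (at x)"
  by (auto simp: schwartz_def dest: spec[of _ "[]"])

lemma schwartz_partial: "f \<in> schwartz \<Longrightarrow> partial i f \<in> schwartz"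
  unfolding schwartz_def
proof safe
  fix js assume *: "\<forall>js. (\<forall>x. foldr partial js f differentiable at x) \<and>
         (\<forall>N. bounded (range (\<lambda>x. norm x ^ N *\<^sub>R foldr partial js f x)))"
  \<comment> \<open>\<open>foldr\<close> applies the last entry of the list first, so the derivative
    already taken is appended at the end.\<close>
  show "foldr partial js (partial i f) differentiable at x" for x
    using *[rule_format, of "js @ [i]"] by simp
  show "bounded (range (\<lambda>x. norm x ^ N *\<^sub>R foldr partial js (partial i f) x))" for N
    using *[rule_format, of "js @ [i]"] by simp
qed

lemma partial_add_scaled:
  assumes "f differentiable (at x)" "g differentiable (at x)"
  shows "partial i (\<lambda>x. f x + c * g x) x = partial i f x + c * partial i g x"
    and "(\<lambda>x. f x + c * g x) differentiable (at x)"
proof -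
  have "(f has_derivative frechet_derivative f (at x)) (at x)"
    "(g has_derivative frechet_derivative g (at x)) (at x)"
    using assms by (auto simp: frechet_derivative_works)
  then have d: "((\<lambda>x. f x + c * g x) has_derivative
      (\<lambda>h. frechet_derivative f (at x) h + c * frechet_derivative g (at x) h)) (at x)"
    by (auto intro!: derivative_eq_intros)
  then show "partial i (\<lambda>x. f x + c * g x) x = partial i f x + c * partial i g x"
    unfolding partial_def frechet_derivative_at[OF d, symmetric] by simp
  show "(\<lambda>x. f x + c * g x) differentiable (at x)"
    using d by (auto simp: differentiable_def)
qed

text \<open>Scaling only one summand covers both uses: sums with \<open>c = 1\<close> for the
  Laplacian, and \<open>c = -1\<close> for \<open>f - laplacian f\<close>.\<close>

lemma schwartz_add_scaled:
  fixes f g :: "real^'n::finite \<Rightarrow> complex"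
  assumes f: "f \<in> schwartz" and g: "g \<in> schwartz"
  shows "(\<lambda>x. f x + c * g x) \<in> schwartz"
proof -
  have eq: "foldr partial js (\<lambda>x. f x + c * g x) = (\<lambda>x. foldr partial js f x + c * foldr partial js g x)" for js
  proof (induction js)
    case (Cons j js)
    then show ?case
      using f g by (auto simp: schwartz_def partial_add_scaled)
  qed simp
  show ?thesis
    unfolding schwartz_def
  proof (safe, unfold eq)
    fix js :: "'n list" and x :: "real^'n" and N :: nat
    show "(\<lambda>x. foldr partial js f x + c * foldr partial js g x) differentiable at x"
      using f g by (intro partial_add_scaled(2)) (auto simp: schwartz_def)
    have "bounded (range (\<lambda>x. norm x ^ N *\<^sub>R foldr partial js f x))"
      "bounded (range (\<lambda>x. norm x ^ N *\<^sub>R foldr partial js g x))"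
      using f g by (auto simp: schwartz_def)
    then obtain K L where KL: "\<And>x. norm (norm x ^ N *\<^sub>R foldr partial js f x) \<le> K" "\<And>x. norm (norm x ^ N *\<^sub>R foldr partial js g x) \<le> L"
      unfolding bounded_iff by auto
    have "norm (c * (norm x ^ N *\<^sub>R foldr partial js g x)) \<le> norm c * L" for x
      unfolding norm_mult[of c] by (intro mult_left_mono KL) simp
    then have "norm (norm x ^ N *\<^sub>R foldr partial js f x + c * (norm x ^ N *\<^sub>R foldr partial js g x)) \<le> K + norm c * L" for x
      by (intro norm_triangle_le add_mono KL)
    then show "bounded (range (\<lambda>x. norm x ^ N *\<^sub>R (foldr partial js f x + c * foldr partial js g x)))"
      unfolding bounded_iff by (auto simp: scaleR_right_distrib intro!: exI[of _ "K + norm c * L"])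
  qed
qed

lemma schwartz_continuous: "f \<in> schwartz \<Longrightarrow> continuous_on UNIV f"
  by (intro continuous_at_imp_continuous_on ballI differentiable_imp_continuous_within schwartz_differentiable)

lemma schwartz_measurable: "f \<in> schwartz \<Longrightarrow> f \<in> borel_measurable borel"
  by (intro borel_measurable_continuous_onI schwartz_continuous)

lemma schwartz_bound:
  fixes f :: "real^'n::finite \<Rightarrow> complex"
  assumes f: "f \<in> schwartz"
  obtains C where "C > 0" "\<And>x. norm (f x) \<le> C * (1 + (norm x)\<^sup>2) powr (- real N)"
proof -
  have "bounded (range (\<lambda>x. norm x ^ M *\<^sub>R f x))" for M
    using f unfolding schwartz_def by (auto dest!: spec[of _ "[]"])
  then have "\<exists>K. \<forall>x. norm (norm x ^ M *\<^sub>R f x) \<le> K" for M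
    unfolding bounded_iff by auto
  then obtain K L where K: "\<And>x. norm (norm x ^ 0 *\<^sub>R f x) \<le> K" and L: "\<And>x. norm (norm x ^ (2 * N) *\<^sub>R f x) \<le> L"
    by metis
  \<comment> \<open>The power of 2 comes from bounding \<open>1 + ?r\<close> by
    \<open>2 * max 1 ?r\<close>; the absolute values and the final \<open>1\<close> make
    \<open>C\<close> positive.\<close>
  define C where "C = 2 ^ N * (\<bar>K\<bar> + \<bar>L\<bar>) + 1"
  have "norm (f x) \<le> C * (1 + (norm x)\<^sup>2) powr (- real N)" for x
  proof -
    let ?r = "(norm x)\<^sup>2"
    have p: "1 + ?r > 0" by (smt (verit) zero_le_power2)
    have "(1 + ?r) ^ N \<le> (2 * max 1 ?r) ^ N"
      by (intro power_mono) auto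
    also have "\<dots> = 2 ^ N * max 1 ?r ^ N" by (simp add: power_mult_distrib)
    also have "\<dots> \<le> 2 ^ N * (1 + ?r ^ N)"
      by (intro mult_left_mono) (auto simp: max_def)
    finally have "(1 + ?r) ^ N * norm (f x) \<le> 2 ^ N * (1 + ?r ^ N) * norm (f x)"
      by (intro mult_right_mono) auto
    also have "\<dots> = 2 ^ N * (norm (norm x ^ 0 *\<^sub>R f x) + norm (norm x ^ (2 * N) *\<^sub>R f x))"
      unfolding power_mult by (simp add: algebra_simps)
    also have "\<dots> \<le> 2 ^ N * (\<bar>K\<bar> + \<bar>L\<bar>)"
      using K[of x] L[of x] by (intro mult_left_mono add_mono) auto
    finally have "(1 + ?r) ^ N * norm (f x) \<le> C" by (simp add: C_def)
    then show ?thesis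
      using p by (simp add: powr_minus powr_realpow field_simps)
  qed
  moreover have "C > 0" by (simp add: C_def add_nonneg_pos)
  ultimately show thesis using that by blast
qed

lemma integrable_of_decay:
  fixes F :: "real^'n::finite \<Rightarrow> 'b::{banach, second_countable_topology}"
  assumes [measurable]: "F \<in> borel_measurable borel"
    and F: "\<And>x. norm (F x) \<le> C * (1 + (norm x)\<^sup>2) powr (- real CARD('n))"
  shows "integrable lborel F"
proof (rule Bochner_Integration.integrable_bound)
  have "integrable lborel (\<lambda>x::real^'n. (1 + (norm x)\<^sup>2) powr (- (2 * real CARD('n)) / 2))"
    by (intro integrable_Japanese) simp
  then show "integrable lborel (\<lambda>x::real^'n. C * (1 + (norm x)\<^sup>2) powr (- real CARD('n)))"
    by simp
  show "AE x in lborel. norm (F x) \<le> norm (C * (1 + (norm x)\<^sup>2) powr (- real CARD('n)))"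
    unfolding real_norm_def by (intro AE_I2 order_trans[OF F abs_ge_self])
qed auto

lemma schwartz_integrable:
  fixes f :: "real^'n::finite \<Rightarrow> complex"
  assumes f: "f \<in> schwartz"
  shows "integrable lborel f"
proof -
  obtain C where "C > 0" and C: "\<And>x. norm (f x) \<le> C * (1 + (norm x)\<^sup>2) powr (- real CARD('n))"
    using schwartz_bound[OF f, where N="CARD('n)"] by blast
  show ?thesis by (rule integrable_of_decay[OF schwartz_measurable[OF f] C])
qed

lemma schwartz_bounded:
  assumes f: "f \<in> schwartz"
  obtains K where "\<And>x. norm (f x) \<le> K"
proof -
  obtain C where "C > 0" and C: "\<And>x. norm (f x) \<le> C * (1 + (norm x)\<^sup>2) powr (- real 0)"
    using schwartz_bound[OF f, where N=0] by blast
  have "norm (f x) \<le> C" for x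
  proof -
    have "1 + (norm x)\<^sup>2 \<noteq> 0" by (smt (verit) zero_le_power2)
    then show ?thesis using C[of x] by simp
  qed
  then show thesis by (rule that)
qed

section \<open>Fourier transforms of derivatives and their decay\<close>

lemma tendsto_difference_quotient:
  assumes "(g has_vector_derivative v) (at (0::real))" and "h \<longlonglongrightarrow> 0" and "\<And>m. h m \<noteq> 0"
  shows "(\<lambda>m. (g (h m) - g 0) /\<^sub>R h m) \<longlonglongrightarrow> v"
proof -
  have "(\<lambda>k. norm (g k - g 0 - k *\<^sub>R v) / norm k) \<midarrow>0\<rightarrow> 0"
    using assms(1) by (simp add: has_vector_derivative_def has_derivative_at)
  moreover have "filterlim h (at 0) sequentially"
    using assms(2,3) by (simp add: filterlim_at)
  ultimately have "(\<lambda>m. norm (g (h m) - g 0 - h m *\<^sub>R v) / norm (h m)) \<longlonglongrightarrow> 0"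
    by (rule filterlim_compose)
  moreover have "norm (g (h m) - g 0 - h m *\<^sub>R v) / norm (h m) = norm ((g (h m) - g 0) /\<^sub>R h m - v)" for m
  proof -
    have "(g (h m) - g 0) /\<^sub>R h m - v = (g (h m) - g 0 - h m *\<^sub>R v) /\<^sub>R h m"
      using assms(3)[of m] by (simp add: scaleR_right_diff_distrib)
    then show ?thesis by (simp add: divide_inverse mult.commute)
  qed
  ultimately have "(\<lambda>m. norm ((g (h m) - g 0) /\<^sub>R h m - v)) \<longlonglongrightarrow> 0"
    by simp
  then show ?thesis
    by (rule LIM_zero_cancel[OF tendsto_norm_zero_cancel])
qed

lemma has_vector_derivative_along_axis:
  fixes f :: "real^'n::finite \<Rightarrow> complex"
  assumes "f differentiable (at (x + s *\<^sub>R axis i 1))"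
  shows "((\<lambda>s. f (x + s *\<^sub>R axis i 1)) has_vector_derivative partial i f (x + s *\<^sub>R axis i 1)) (at s)"
proof -
  let ?y = "x + s *\<^sub>R axis i 1"
  have "(f has_derivative frechet_derivative f (at ?y)) (at ?y)"
    using assms by (simp add: frechet_derivative_works)
  moreover have "((\<lambda>s. x + s *\<^sub>R axis i 1) has_derivative (\<lambda>h. h *\<^sub>R axis i 1)) (at s)"
    by (auto intro!: derivative_eq_intros)
  ultimately have "((\<lambda>s. f (x + s *\<^sub>R axis i 1)) has_derivative (\<lambda>h. frechet_derivative f (at ?y) (h *\<^sub>R axis i 1))) (at s)"
    by (rule has_derivative_compose[rotated])
  then show ?thesis
    unfolding has_vector_derivative_def partial_def
    using linear_frechet_derivative[OF assms] by (simp add: linear_scale)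
qed

text \<open>Peetre's inequality for shifts of length at most one. It transfers decay at an
  intermediate point of a short segment to the endpoint \<open>x\<close>.\<close>

lemma Japanese_shift_le:
  fixes x v :: "'a::euclidean_space"
  assumes v: "norm v \<le> 1"
  shows "(1 + (norm (x + v))\<^sup>2) powr (- real N) \<le> 3 ^ N * (1 + (norm x)\<^sup>2) powr (- real N)"
proof -
  have p: "1 + (norm y)\<^sup>2 > 0" for y :: 'a by (smt (verit) zero_le_power2)
  have "norm x \<le> norm (x + v) + 1"
    using norm_triangle_ineq4[of "x + v" v] v by simp
  then have "(norm x)\<^sup>2 \<le> (norm (x + v) + 1)\<^sup>2"
    by (intro power_mono) auto
  also have "\<dots> \<le> 2 * (norm (x + v))\<^sup>2 + 2"
    using sum_squares_bound[of "norm (x + v)" 1] by (simp add: power2_eq_square algebra_simps)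
  finally have "(norm x)\<^sup>2 \<le> 2 * (norm (x + v))\<^sup>2 + 2" .
  moreover have "0 \<le> (norm (x + v))\<^sup>2" by simp
  ultimately have "1 + (norm x)\<^sup>2 \<le> 3 * (1 + (norm (x + v))\<^sup>2)"
    unfolding distrib_left by linarith
  then have "(1 + (norm x)\<^sup>2) ^ N \<le> 3 ^ N * (1 + (norm (x + v))\<^sup>2) ^ N"
    unfolding power_mult_distrib[symmetric] by (intro power_mono) (auto simp: add_nonneg_nonneg)
  then show ?thesis
    using p[of x] p[of "x + v"] by (simp add: powr_minus powr_realpow field_simps)
qed

text \<open>The mean value inequality along a coordinate segment. The bound does not depend on
  \<open>h\<close>, so with a suitable \<open>N\<close> it is an integrable majorant for all
  difference quotients at once.\<close>

lemma schwartz_increment_le: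
  fixes f :: "real^'n::finite \<Rightarrow> complex"
  assumes f: "f \<in> schwartz"
  obtains C where "\<And>x h. 0 < h \<Longrightarrow> h \<le> 1 \<Longrightarrow>
    norm ((f (x + h *\<^sub>R axis i 1) - f x) /\<^sub>R h) \<le> C * (1 + (norm x)\<^sup>2) powr (- real N)"
proof -
  obtain C where C: "C > 0" "\<And>x. norm (partial i f x) \<le> C * (1 + (norm x)\<^sup>2) powr (- real N)"
    using schwartz_bound[OF schwartz_partial[OF f], where N=N] by blast
  have "norm ((f (x + h *\<^sub>R axis i 1) - f x) /\<^sub>R h) \<le> C * 3 ^ N * (1 + (norm x)\<^sup>2) powr (- real N)"
    if h: "0 < h" "h \<le> 1" for x h
  proof -
    let ?B = "C * 3 ^ N * (1 + (norm x)\<^sup>2) powr (- real N)"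
    let ?g = "\<lambda>s. f (x + s *\<^sub>R axis i 1)"
    have "norm (?g h - ?g 0) \<le> ?B * norm (h - 0)"
    proof (rule differentiable_bound[where S="{0..h}"])
      fix s assume s: "s \<in> {0..h}"
      let ?v = "partial i f (x + s *\<^sub>R axis i 1)"
      show "(?g has_derivative (\<lambda>k. k *\<^sub>R ?v)) (at s within {0..h})"
        using has_vector_derivative_along_axis[OF schwartz_differentiable[OF f], where x=x and s=s and i=i]
        by (auto simp: has_vector_derivative_def intro: has_derivative_at_withinI)
      have "norm ?v \<le> C * (1 + (norm (x + s *\<^sub>R axis i 1))\<^sup>2) powr (- real N)"
        by (rule C)
      also have "\<dots> \<le> C * (3 ^ N * (1 + (norm x)\<^sup>2) powr (- real N))"
        using s h C(1) by (intro mult_left_mono Japanese_shift_le) auto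
      finally have "norm ?v \<le> ?B" by simp
      then show "onorm (\<lambda>k. k *\<^sub>R ?v) \<le> ?B"
        by (intro onorm_le) (auto simp: mult.commute intro!: mult_left_mono)
    qed (use h in auto)
    then have "norm (f (x + h *\<^sub>R axis i 1) - f x) \<le> ?B * h" using h by simp
    then show ?thesis
      using h unfolding norm_scaleR by (simp add: divide_inverse[symmetric] pos_divide_le_eq mult.commute[of "inverse h"])
  qed
  then show thesis by (rule that)
qed

text \<open>Obtained from the Fourier transform of the difference quotients, by dominated convergence.\<close>

lemma fourier_partial:
  fixes f :: "real^'n::finite \<Rightarrow> complex"
  assumes f: "f \<in> schwartz"
  shows "fourier (partial i f) y = \<i> * complex_of_real (y $ i) * fourier f y"
proof -
  have [measurable]: "f \<in> borel_measurable borel" "partial i f \<in> borel_measurable borel"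
    using f by (auto intro: schwartz_measurable schwartz_partial)
  define h where "h = (\<lambda>m::nat. inverse (real (Suc m)))"
  have h: "h m > 0" "h m \<le> 1" "h m \<noteq> 0" for m by (auto simp: h_def field_simps)
  have hlim: "h \<longlonglongrightarrow> 0" unfolding h_def by (rule LIMSEQ_inverse_real_of_nat)
  let ?q = "\<lambda>m x. (f (x + h m *\<^sub>R axis i 1) - f x) /\<^sub>R h m"
  obtain C where C: "\<And>x h. 0 < h \<Longrightarrow> h \<le> 1 \<Longrightarrow>
    norm ((f (x + h *\<^sub>R axis i 1) - f x) /\<^sub>R h) \<le> C * (1 + (norm x)\<^sup>2) powr (- real CARD('n))"
    using schwartz_increment_le[OF f, where N="CARD('n)"] by blast
  have "(\<lambda>m. fourier (?q m) y) \<longlonglongrightarrow> fourier (partial i f) y"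
    unfolding fourier_def
  proof (rule integral_dominated_convergence)
    show "integrable lborel (\<lambda>x::real^'n. C * (1 + (norm x)\<^sup>2) powr (- real CARD('n)))"
      using integrable_Japanese[where 'a="real^'n" and s="2 * real CARD('n)"] by simp
    show "AE x in lborel. norm (cis (- (x \<bullet> y)) * ?q m x) \<le> C * (1 + (norm x)\<^sup>2) powr (- real CARD('n))" for m
      using C[OF h(1,2)] by (simp add: norm_mult)
    have "(\<lambda>m. ?q m x) \<longlonglongrightarrow> partial i f x" for x
      using tendsto_difference_quotient[OF has_vector_derivative_along_axis[OF schwartz_differentiable[OF f], where x=x and s=0 and i=i] hlim h(3)]
      by simp
    then show "AE x in lborel. (\<lambda>m. cis (- (x \<bullet> y)) * ?q m x) \<longlonglongrightarrow> cis (- (x \<bullet> y)) * partial i f x"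
      by (intro AE_I2 tendsto_intros)
  qed auto
  \<comment> \<open>Translation of the integration variable turns the shift by \<open>h m\<close>
    into a phase, so the difference quotient falls on \<open>cis\<close> at frequency
    \<open>y $ i\<close>.\<close>
  moreover have "fourier (?q m) y = ((cis (h m * y $ i) - cis (0 * y $ i)) /\<^sub>R h m) * fourier f y" for m
  proof -
    let ?e = "h m *\<^sub>R axis i 1 :: real^'n"
    have eq: "cis (- (x \<bullet> y)) * ?q m x = (cis (h m * y $ i) * (cis (- ((?e + 1 *\<^sub>R x) \<bullet> y)) * f (?e + 1 *\<^sub>R x)) - cis (- (x \<bullet> y)) * f x) /\<^sub>R h m" for x
    proof -
      have *: "cis (h m * y $ i) * cis (- ((x + ?e) \<bullet> y)) = cis (- (x \<bullet> y))"
        by (simp add: cis_mult inner_add_left inner_axis')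
      show ?thesis
        unfolding scaleR_one mult.assoc[symmetric] * add.commute[of ?e]
        by (simp only: mult_scaleR_right right_diff_distrib)
    qed
    have f1: "integrable lborel (\<lambda>x. cis (- (x \<bullet> y)) * f x)"
      by (intro integrable_cis_mult schwartz_integrable f) measurable
    have f2: "integrable lborel (\<lambda>x. cis (- ((?e + 1 *\<^sub>R x) \<bullet> y)) * f (?e + 1 *\<^sub>R x))"
      by (rule integrable_lborel_affine[OF _ f1]) simp
    have I: "(LINT x|lborel. cis (- ((?e + 1 *\<^sub>R x) \<bullet> y)) * f (?e + 1 *\<^sub>R x)) = fourier f y"
      unfolding fourier_def by (subst (2) integral_lborel_affine[of 1 _ ?e]) auto
    have "fourier (?q m) y = (LINT x|lborel. (cis (h m * y $ i) * (cis (- ((?e + 1 *\<^sub>R x) \<bullet> y)) * f (?e + 1 *\<^sub>R x)) - cis (- (x \<bullet> y)) * f x) /\<^sub>R h m)"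
      unfolding fourier_def eq ..
    also have "\<dots> = (cis (h m * y $ i) * fourier f y - fourier f y) /\<^sub>R h m"
      unfolding integral_scaleR_right
      by (subst Bochner_Integration.integral_diff)
         (use f1 f2 I in \<open>auto simp: fourier_def[symmetric] simp del: scaleR_one\<close>)
    finally show ?thesis by (simp add: left_diff_distrib)
  qed
  moreover have "(\<lambda>m. (cis (h m * y $ i) - cis (0 * y $ i)) /\<^sub>R h m * fourier f y) \<longlonglongrightarrow> \<i> * complex_of_real (y $ i) * fourier f y"
  proof (intro tendsto_mult_right tendsto_difference_quotient[OF _ hlim h(3)])
    have "((\<lambda>s. exp (\<i> * complex_of_real (y $ i) * complex_of_real s)) has_vector_derivative \<i> * complex_of_real (y $ i)) (at 0)"
      by (rule has_vector_derivative_real_field) (auto intro!: derivative_eq_intros)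
    then show "((\<lambda>s. cis (s * y $ i)) has_vector_derivative \<i> * complex_of_real (y $ i)) (at 0)"
      by (simp add: cis_conv_exp mult_ac)
  qed
  ultimately show ?thesis using LIMSEQ_unique by simp
qed

lemma schwartz_zero: "(\<lambda>_. 0) \<in> (schwartz :: (real^'n::finite \<Rightarrow> complex) set)"
proof -
  have "foldr partial js (\<lambda>_. 0) = (\<lambda>_::real^'n. 0::complex)" for js
  proof (induction js)
    case (Cons j js)
    have "partial j (\<lambda>_. 0) = (\<lambda>_::real^'n. 0::complex)"
      by (simp add: partial_def fun_eq_iff)
    with Cons show ?case by simp
  qed simp
  then show ?thesis by (auto simp: schwartz_def)
qed

lemma schwartz_laplacian:
  fixes f :: "real^'n::finite \<Rightarrow> complex"
  assumes f: "f \<in> schwartz"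
  shows "laplacian f \<in> schwartz"
proof -
  have "(\<lambda>x. \<Sum>i\<in>I. partial i (partial i f) x) \<in> schwartz" if "finite I" for I
    using that
  proof induction
    case (insert i I)
    then show ?case
      using schwartz_add_scaled[OF schwartz_partial[OF schwartz_partial[OF f]] insert.IH, of i i 1] by simp
  qed (simp add: schwartz_zero)
  then show ?thesis by (simp add: laplacian_def[abs_def])
qed

lemma fourier_laplacian:
  fixes f :: "real^'n::finite \<Rightarrow> complex"
  assumes f: "f \<in> schwartz"
  shows "fourier (laplacian f) y = - complex_of_real ((norm y)\<^sup>2) * fourier f y"
proof -
  have "integrable lborel (\<lambda>x. cis (- (x \<bullet> y)) * partial i (partial i f) x)" for i
    by (intro integrable_cis_mult schwartz_integrable schwartz_partial f) measurable
  then have "fourier (laplacian f) y = (\<Sum>i\<in>UNIV. fourier (partial i (partial i f)) y)"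
    unfolding fourier_def laplacian_def sum_distrib_left by (rule Bochner_Integration.integral_sum)
  also have "\<dots> = (\<Sum>i\<in>UNIV. - complex_of_real ((y $ i)\<^sup>2) * fourier f y)"
  proof (rule sum.cong)
    fix i
    show "fourier (partial i (partial i f)) y = - complex_of_real ((y $ i)\<^sup>2) * fourier f y"
      unfolding fourier_partial[OF schwartz_partial[OF f]] fourier_partial[OF f]
      by (simp add: power2_eq_square mult.assoc[symmetric]) (simp add: mult_ac)
  qed simp
  also have "\<dots> = - complex_of_real (\<Sum>i\<in>UNIV. (y $ i)\<^sup>2) * fourier f y"
    by (simp add: sum_distrib_right sum_negf)
  also have "(\<Sum>i\<in>UNIV. (y $ i)\<^sup>2) = (norm y)\<^sup>2"
    unfolding power2_norm_eq_inner inner_vec_def by (simp add: power2_eq_square)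
  finally show ?thesis .
qed

lemma schwartz_minus_laplacian:
  "f \<in> schwartz \<Longrightarrow> (\<lambda>x. f x - laplacian f x) \<in> schwartz"
  using schwartz_add_scaled[OF _ schwartz_laplacian, of f f "-1"] by simp

lemma fourier_minus_laplacian:
  fixes f :: "real^'n::finite \<Rightarrow> complex"
  assumes f: "f \<in> schwartz"
  shows "fourier (\<lambda>x. f x - laplacian f x) y = complex_of_real (1 + (norm y)\<^sup>2) * fourier f y"
proof -
  have "fourier (\<lambda>x. f x - laplacian f x) y = fourier f y - fourier (laplacian f) y"
    unfolding fourier_def right_diff_distrib
    by (intro Bochner_Integration.integral_diff integrable_cis_mult schwartz_integrable schwartz_laplacian f) measurable
  then show ?thesis by (simp add: fourier_laplacian[OF f] distrib_right)
qed

lemma Japanese_powr_Suc: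
  "(1 + (norm y)\<^sup>2) powr (- real (Suc N)) = (1 + (norm y)\<^sup>2) powr (- real N) / (1 + (norm y)\<^sup>2)"
proof -
  have p: "1 + (norm y)\<^sup>2 > 0" by (smt (verit) zero_le_power2)
  have "- real (Suc N) = - real N - 1" by simp
  then show ?thesis using p by (simp only: powr_diff) simp
qed

text \<open>Passing from \<open>f\<close> to \<open>f - laplacian f\<close> multiplies the transform
  by \<open>1 + (norm y)\<^sup>2\<close>, so each induction step gains one power of decay; hence the
  induction keeps \<open>f\<close> arbitrary.\<close>

lemma fourier_decay:
  fixes f :: "real^'n::finite \<Rightarrow> complex"
  assumes "f \<in> schwartz"
  shows "\<exists>C. \<forall>y. norm (fourier f y) \<le> C * (1 + (norm y)\<^sup>2) powr (- real N)"
  using assms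
proof (induction N arbitrary: f)
  case 0
  have "1 + (norm y)\<^sup>2 \<noteq> 0" for y :: "real^'n" by (smt (verit) zero_le_power2)
  then show ?case using norm_fourier_le[of f] by (auto intro!: exI[of _ "LINT x|lborel. norm (f x)"])
next
  case (Suc N)
  obtain C where C: "\<And>y. norm (fourier (\<lambda>x. f x - laplacian f x) y) \<le> C * (1 + (norm y)\<^sup>2) powr (- real N)"
    using Suc.IH[OF schwartz_minus_laplacian[OF Suc.prems]] by auto
  have "norm (fourier f y) \<le> C * (1 + (norm y)\<^sup>2) powr (- real (Suc N))" for y
  proof -
    have p: "1 + (norm y)\<^sup>2 > 0" by (smt (verit) zero_le_power2)
    have "(1 + (norm y)\<^sup>2) * norm (fourier f y) \<le> C * (1 + (norm y)\<^sup>2) powr (- real N)"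
      using C[of y] p unfolding fourier_minus_laplacian[OF Suc.prems] norm_mult norm_of_real by simp
    then have "norm (fourier f y) \<le> C * ((1 + (norm y)\<^sup>2) powr (- real N) / (1 + (norm y)\<^sup>2))"
      using p by (simp add: pos_le_divide_eq mult.commute)
    also have "(1 + (norm y)\<^sup>2) powr (- real N) / (1 + (norm y)\<^sup>2) = (1 + (norm y)\<^sup>2) powr (- real (Suc N))"
      by (rule Japanese_powr_Suc[symmetric])
    finally show ?thesis .
  qed
  then show ?case by blast
qed

text \<open>These are the hypotheses of Fourier inversion for a symbol of at most quadratic growth
  times a transform, apart from integrability of the inverse transform.\<close>

lemma
  fixes f :: "real^'n::finite \<Rightarrow> complex" and a :: "real^'n \<Rightarrow> real"
  assumes f: "f \<in> schwartz" and a: "continuous_on UNIV a" and K: "\<And>y. \<bar>a y\<bar> \<le> K * (1 + (norm y)\<^sup>2)"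
  shows integrable_symbol_fourier: "integrable lborel (\<lambda>y. complex_of_real (a y) * fourier f y)"
    and continuous_symbol_fourier: "continuous_on UNIV (\<lambda>y. complex_of_real (a y) * fourier f y)"
    and bounded_symbol_fourier: "\<exists>B. \<forall>y. norm (complex_of_real (a y) * fourier f y) \<le> B"
proof -
  \<comment> \<open>One power of \<open>1 + (norm y)\<^sup>2\<close> absorbs the growth of the
    symbol; the remaining ones ensure integrability.\<close>
  let ?N = "Suc CARD('n)"
  obtain C where C: "\<And>y. norm (fourier f y) \<le> C * (1 + (norm y)\<^sup>2) powr (- real ?N)"
    using fourier_decay[OF f] by blast
  show c: "continuous_on UNIV (\<lambda>y. complex_of_real (a y) * fourier f y)"
    by (intro continuous_intros continuous_fourier schwartz_integrable f a)
  have le: "norm (complex_of_real (a y) * fourier f y) \<le> K * C * (1 + (norm y)\<^sup>2) powr (- real CARD('n))" for y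
  proof -
    have p: "1 + (norm y)\<^sup>2 > 0" by (smt (verit) zero_le_power2)
    have "norm (complex_of_real (a y) * fourier f y) \<le> (K * (1 + (norm y)\<^sup>2)) * (C * (1 + (norm y)\<^sup>2) powr (- real ?N))"
      unfolding norm_mult norm_of_real using K[of y] C[of y] by (intro mult_mono) auto
    also have "(1 + (norm y)\<^sup>2) powr (- real ?N) = (1 + (norm y)\<^sup>2) powr (- real CARD('n)) / (1 + (norm y)\<^sup>2)"
      using Japanese_powr_Suc[of y "CARD('n)"] by simp
    finally show ?thesis using p by simp
  qed
  show "integrable lborel (\<lambda>y. complex_of_real (a y) * fourier f y)"
    by (rule integrable_of_decay[OF _ le]) (use borel_measurable_continuous_onI[OF c] in simp)
  have KC: "0 \<le> K * C"
    using order_trans[OF norm_ge_zero le[of 0]] by simp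
  have "(1 + (norm y)\<^sup>2) powr (- real CARD('n)) \<le> 1" for y :: "real^'n"
    using powr_mono2'[of "- real CARD('n)" 1 "1 + (norm y)\<^sup>2"] by simp
  then have "norm (complex_of_real (a y) * fourier f y) \<le> K * C * 1" for y
    using KC by (intro order_trans[OF le] mult_left_mono) auto
  then show "\<exists>B. \<forall>y. norm (complex_of_real (a y) * fourier f y) \<le> B" by blast
qed

text \<open>Identifies the norm on the right of the second estimate as the norm of an honest
  Schwartz function, on which the multiplier bounds can act. Inversion is unconditional here because
  the transform of that function is integrable.\<close>

lemma bessel_op_2:
  fixes g :: "real^'n::finite \<Rightarrow> complex"
  assumes g: "g \<in> schwartz"
  shows "bessel_op 2 g = (\<lambda>x. g x - laplacian g x)"
proof -
  let ?h = "\<lambda>x. g x - laplacian g x"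
  have h: "?h \<in> schwartz" by (rule schwartz_minus_laplacian[OF g])
  obtain K where K: "\<And>x. norm (?h x) \<le> K" using schwartz_bounded[OF h] by blast
  have "1 + (norm y)\<^sup>2 > 0" for y :: "real^'n" by (smt (verit) zero_le_power2)
  then have "bessel_op 2 g = inv_fourier (fourier ?h)"
    unfolding bessel_op_def fourier_multiplier_def
    by (intro arg_cong[of _ _ inv_fourier] ext) (simp add: fourier_minus_laplacian[OF g])
  also have "\<dots> = ?h"
    using integrable_symbol_fourier[OF h, of "\<lambda>_. 1" 1]
    by (intro inv_fourier_fourier[OF schwartz_integrable[OF h] schwartz_continuous[OF h] K]) simp
  finally show ?thesis .
qed

text \<open>
  If \<open>inv_fourier F\<close> is not integrable then its \<open>fourier\<close> transform is the junk value \<open>0\<close>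
  of the Bochner integral. Admitting this second alternative avoids having to show that multiplier
  operators preserve the Schwartz space.
\<close>

lemma fourier_inv_fourier_or_zero:
  fixes F :: "real^'n::finite \<Rightarrow> complex"
  assumes F: "integrable lborel F" "continuous_on UNIV F" "\<exists>K. \<forall>x. norm (F x) \<le> K"
  shows "fourier (inv_fourier F) = F \<or> fourier (inv_fourier F) = (\<lambda>_. 0)"
proof (cases "integrable lborel (inv_fourier F)")
  case True
  then show ?thesis using F fourier_inv_fourier by blast
next
  case False
  \<comment> \<open>A unimodular factor does not affect integrability, so every value of the
    transform is the default \<open>0\<close>.\<close>
  have "\<not> integrable lborel (\<lambda>x. cis (- (x \<bullet> y)) * inv_fourier F x)" for y
  proof
    assume "integrable lborel (\<lambda>x. cis (- (x \<bullet> y)) * inv_fourier F x)"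
    then have "integrable lborel (\<lambda>x. cis (x \<bullet> y) * (cis (- (x \<bullet> y)) * inv_fourier F x))"
      by (rule integrable_cis_mult) measurable
    then show False using False by (simp add: cis_mult mult.assoc[symmetric])
  qed
  then show ?thesis by (auto simp: fourier_def fun_eq_iff not_integrable_integral_eq)
qed

section \<open>The symbols\<close>

text \<open>For \<open>y \<noteq> 0\<close> the symbol is the impulse response of a damped
  oscillator in \<open>t\<close>, with characteristic roots of real part \<open>- damping y\<close>
  and imaginary part plus or minus \<open>frequency y\<close>.\<close>

definition damping :: "real^'n::finite \<Rightarrow> real" where
  "damping y = (norm y)\<^sup>2 / (2 * (1 + (norm y)\<^sup>2))"

definition root_factor :: "real^'n::finite \<Rightarrow> real" where
  "root_factor y = sqrt (3 + 4 * (norm y)\<^sup>2)"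

definition frequency :: "real^'n::finite \<Rightarrow> real" where
  "frequency y = damping y * root_factor y"

text \<open>Since \<open>damping y\<close> is \<open>frequency y\<close> divided by
  \<open>root_factor y\<close>, the derivative can be written without dividing by the frequency. The
  formula therefore includes \<open>y = 0\<close>, where its value is \<open>1\<close>.\<close>

definition symbol_m_1 :: "real^'n::finite \<Rightarrow> real \<Rightarrow> real" where
  "symbol_m_1 y t = exp (- (damping y * t)) * (cos (frequency y * t) - sin (frequency y * t) / root_factor y)"

definition symbol_m_2 :: "real^'n::finite \<Rightarrow> real \<Rightarrow> real" where
  "symbol_m_2 y t = exp (- (damping y * t)) *
    (- 2 * damping y * cos (frequency y * t) + (damping y / root_factor y - frequency y) * sin (frequency y * t))"

lemma Japanese_pos: "0 < 1 + (norm y)\<^sup>2"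
  by (smt (verit) zero_le_power2)

lemma root_factor_ge_1: "1 \<le> root_factor y"
  by (simp add: root_factor_def)

lemma root_factor_pos: "0 < root_factor y"
  using root_factor_ge_1[of y] by linarith

lemma symbol_m_nonzero:
  assumes "y \<noteq> 0"
  shows "symbol_m y t = exp (- (damping y * t)) * (1 / frequency y) * sin (frequency y * t)"
  using assms Japanese_pos[of y]
  by (simp add: symbol_m_def damping_def frequency_def root_factor_def)

lemma has_real_derivative_symbol_m: "(symbol_m y has_real_derivative symbol_m_1 y t) (at t)"
proof (cases "y = 0")
  case True
  then have "symbol_m y = (\<lambda>t. t)" "symbol_m_1 y t = 1"
    by (auto simp: symbol_m_def symbol_m_1_def damping_def frequency_def fun_eq_iff)
  then show ?thesis by simp
next
  case False
  then have d: "0 < damping y" using Japanese_pos[of y] by (simp add: damping_def)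
  have "((\<lambda>t. exp (- (damping y * t)) * (1 / frequency y) * sin (frequency y * t)) has_real_derivative symbol_m_1 y t) (at t)"
    unfolding symbol_m_1_def frequency_def using d root_factor_pos[of y]
    by (auto intro!: derivative_eq_intros simp: field_simps)
  moreover have "symbol_m y = (\<lambda>t. exp (- (damping y * t)) * (1 / frequency y) * sin (frequency y * t))"
    using symbol_m_nonzero[OF False] by blast
  ultimately show ?thesis by (simp only:)
qed

lemma has_real_derivative_symbol_m_1: "(symbol_m_1 y has_real_derivative symbol_m_2 y t) (at t)"
  unfolding symbol_m_1_def[abs_def] symbol_m_2_def frequency_def using root_factor_pos[of y]
  by (auto intro!: derivative_eq_intros simp: field_simps)

lemma deriv_symbol_m: "deriv (symbol_m y) = symbol_m_1 y"
  by (intro ext DERIV_imp_deriv has_real_derivative_symbol_m)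

lemma deriv_symbol_m_1: "deriv (symbol_m_1 y) = symbol_m_2 y"
  by (intro ext DERIV_imp_deriv has_real_derivative_symbol_m_1)

text \<open>The square of the norm cancels the quotient by \<open>frequency y\<close>, which
  vanishes at the origin. In this form continuity at \<open>y = 0\<close> and a bound uniform in
  \<open>t\<close> can be read off.\<close>

lemma norm_sq_symbol_m:
  "(norm y)\<^sup>2 * symbol_m y t =
    exp (- (damping y * t)) * (2 * (1 + (norm y)\<^sup>2) / root_factor y) * sin (frequency y * t)"
proof (cases "y = 0")
  case False
  then show ?thesis
    using Japanese_pos[of y] root_factor_pos[of y]
    by (simp add: symbol_m_nonzero damping_def frequency_def)
qed (simp add: frequency_def damping_def)

lemma continuous_symbol_parts [continuous_intros]:
  "continuous_on UNIV (\<lambda>y::real^'n::finite. damping y)"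
  "continuous_on UNIV (\<lambda>y::real^'n::finite. root_factor y)"
  "continuous_on UNIV (\<lambda>y::real^'n::finite. frequency y)"
proof -
  have ne: "2 * (1 + (norm y)\<^sup>2) \<noteq> 0" for y :: "real^'n"
    using Japanese_pos[of y] by simp
  show d: "continuous_on UNIV (\<lambda>y::real^'n. damping y)"
    unfolding damping_def by (intro continuous_intros ballI ne)
  show r: "continuous_on UNIV (\<lambda>y::real^'n. root_factor y)"
    unfolding root_factor_def by (intro continuous_intros)
  show "continuous_on UNIV (\<lambda>y::real^'n. frequency y)"
    unfolding frequency_def by (intro continuous_intros d r)
qed

lemma damping_nonneg: "0 \<le> damping y" and damping_le: "damping y \<le> 1 / 2"
  using Japanese_pos[of y] by (auto simp: damping_def field_simps)

lemma frequency_nonneg: "0 \<le> frequency y"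
  using damping_nonneg[of y] root_factor_pos[of y] by (simp add: frequency_def)

lemma root_factor_le: "root_factor y \<le> 2 * sqrt (1 + (norm y)\<^sup>2)"
proof -
  have "root_factor y \<le> sqrt (4 * (1 + (norm y)\<^sup>2))"
    unfolding root_factor_def by (intro real_sqrt_le_mono) simp
  then show ?thesis unfolding real_sqrt_mult by simp
qed

lemma frequency_le: "frequency y \<le> sqrt (1 + (norm y)\<^sup>2)"
proof -
  have "frequency y \<le> 1 / 2 * (2 * sqrt (1 + (norm y)\<^sup>2))"
    unfolding frequency_def using damping_nonneg[of y] damping_le[of y] root_factor_pos[of y] root_factor_le[of y]
    by (intro mult_mono) auto
  then show ?thesis by simp
qed

lemma abs_symbol_m_1_le: "\<bar>symbol_m_1 y t\<bar> \<le> 2 * exp (- (damping y * t))"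
proof -
  have "\<bar>sin (frequency y * t) / root_factor y\<bar> \<le> 1"
    using root_factor_ge_1[of y] by (auto simp: divide_le_eq intro: order_trans[OF abs_sin_le_one])
  then have "\<bar>cos (frequency y * t) - sin (frequency y * t) / root_factor y\<bar> \<le> 2"
    using abs_cos_le_one[of "frequency y * t"] by linarith
  then show ?thesis
    unfolding symbol_m_1_def abs_mult by (simp add: mult.commute)
qed

text \<open>Compared with the first derivative, the second costs one factor
  \<open>frequency y\<close>, hence one order of growth. The Sobolev index on the left is lower by
  one for \<open>k = 2\<close>, which compensates.\<close>

lemma abs_symbol_m_2_le: "\<bar>symbol_m_2 y t\<bar> \<le> 3 * sqrt (1 + (norm y)\<^sup>2) * exp (- (damping y * t))"
proof -
  let ?j = "sqrt (1 + (norm y)\<^sup>2)"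
  have j: "1 \<le> ?j" by simp
  have "\<bar>- 2 * damping y * cos (frequency y * t)\<bar> \<le> 1 * 1"
    unfolding abs_mult[of "- 2 * damping y"] using damping_nonneg[of y] damping_le[of y]
    by (intro mult_mono abs_cos_le_one) auto
  moreover have "\<bar>(damping y / root_factor y - frequency y) * sin (frequency y * t)\<bar> \<le> (1 + ?j) * 1"
    unfolding abs_mult
  proof (intro mult_mono abs_sin_le_one)
    have "0 \<le> damping y / root_factor y" "damping y / root_factor y \<le> 1"
      using damping_nonneg[of y] damping_le[of y] root_factor_ge_1[of y] by (auto simp: divide_le_eq)
    then show "\<bar>damping y / root_factor y - frequency y\<bar> \<le> 1 + ?j"
      using frequency_nonneg[of y] frequency_le[of y] by linarith
  qed auto
  ultimately have "\<bar>- 2 * damping y * cos (frequency y * t) + (damping y / root_factor y - frequency y) * sin (frequency y * t)\<bar> \<le> 1 * 1 + (1 + ?j) * 1"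
    by (intro order_trans[OF abs_triangle_ineq add_mono])
  also have "\<dots> \<le> 3 * ?j" using j by simp
  finally show ?thesis
    unfolding symbol_m_2_def abs_mult[of "exp _"] by (simp add: mult.commute)
qed

text \<open>Division by \<open>root_factor y\<close> gains an order, so the product has order one
  instead of two; relative to \<open>(I - \<Delta>) g\<close> it has order
  \<open>-1\<close>.\<close>

lemma abs_norm_sq_symbol_m_le: "\<bar>(norm y)\<^sup>2 * symbol_m y t\<bar> \<le> 2 * sqrt (1 + (norm y)\<^sup>2) * exp (- (damping y * t))"
proof -
  let ?j = "sqrt (1 + (norm y)\<^sup>2)"
  have j: "1 \<le> ?j" by simp
  have "?j \<le> root_factor y"
    unfolding root_factor_def by (intro real_sqrt_le_mono) auto
  then have "?j * ?j \<le> ?j * root_factor y" by (intro mult_left_mono) auto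
  moreover have "?j * ?j = 1 + (norm y)\<^sup>2" using Japanese_pos[of y] by simp
  ultimately have "2 * (1 + (norm y)\<^sup>2) / root_factor y \<le> 2 * ?j"
    using root_factor_pos[of y] by (simp add: divide_le_eq)
  moreover have "0 \<le> 2 * (1 + (norm y)\<^sup>2) / root_factor y"
    using root_factor_pos[of y] Japanese_pos[of y] by (intro divide_nonneg_pos) auto
  ultimately have "\<bar>2 * (1 + (norm y)\<^sup>2) / root_factor y\<bar> * \<bar>sin (frequency y * t)\<bar> \<le> (2 * ?j) * 1"
    by (intro mult_mono abs_sin_le_one) auto
  then have "exp (- (damping y * t)) * (\<bar>2 * (1 + (norm y)\<^sup>2) / root_factor y\<bar> * \<bar>sin (frequency y * t)\<bar>)
    \<le> exp (- (damping y * t)) * (2 * ?j * 1)"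
    by (rule mult_left_mono) simp
  then show ?thesis
    unfolding norm_sq_symbol_m abs_mult by (simp add: mult_ac)
qed

section \<open>Reduction of all four estimates to the damped weight\<close>

lemma damped_weight_eq:
  "damped_weight s t y = (1 + (norm y)\<^sup>2) powr (- s / 2) * exp (- (damping y * t))"
  by (simp add: damped_weight_def damping_def)

text \<open>The constant is chosen before exponents, symbol, function and time. The power of
  \<open>t\<close> comes solely from the \<open>L\<^sup>1\<close> to
  \<open>L\<^sup>\<infinity>\<close> bound, which interpolation raises to the power
  \<open>1 - 2 / p\<close>.\<close>

lemma Lp_norm_damped_multiplier_le:
  assumes s: "s > real CARD('n::finite)"
  shows "\<exists>C>0. \<forall>(p::ennreal) q b f t. 2 \<le> p \<longrightarrow> 1 / p + 1 / q = 1 \<longrightarrow> t > 0 \<longrightarrow>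
    b \<in> borel_measurable borel \<longrightarrow> (\<forall>y. \<bar>b y\<bar> \<le> 3 * damped_weight s t y) \<longrightarrow> integrable lborel f \<longrightarrow>
    Lp_norm p (fourier_multiplier b (f :: real^'n \<Rightarrow> complex)) \<le>
      ennreal (C * t powr (- (real CARD('n) / 2) * (1 - 2 * enn2real (1 / p)))) * Lp_norm q f"
proof -
  let ?n = "real CARD('n)" and ?P = "(2 * pi) ^ CARD('n)"
  obtain K where K: "K > 0" and int: "\<And>t. t > 0 \<Longrightarrow> integrable lborel (damped_weight s t :: real^'n \<Rightarrow> real)"
    and le: "\<And>t. t > 0 \<Longrightarrow> (LINT y|lborel. damped_weight s t (y :: real^'n)) \<le> K * t powr (- ?n / 2)"
    using integral_damped_weight_le[OF s] by blast
  \<comment> \<open>The two interpolated powers of 3 multiply to 3 for every \<open>p\<close>. The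
    remaining power of \<open>K / ?P\<close> has exponent between \<open>0\<close> and
    \<open>1\<close>, hence the maximum with \<open>1\<close>.\<close>
  define C where "C = exp 1 * (3 * max 1 (K / ?P))"
  have C: "C > 0" by (simp add: C_def)
  have "Lp_norm p (fourier_multiplier b f) \<le> ennreal (C * t powr (- (?n / 2) * (1 - 2 * enn2real (1 / p)))) * Lp_norm q f"
    if p: "2 \<le> p" "1 / p + 1 / q = 1" and t: "t > 0" and bm: "b \<in> borel_measurable borel"
      and b: "\<And>y. \<bar>b y\<bar> \<le> 3 * damped_weight s t y" and f: "integrable lborel f"
    for p q :: ennreal and b and f :: "real^'n \<Rightarrow> complex" and t
  proof -
    define B where "B = 3 * (K / ?P) * t powr (- ?n / 2)"
    have B: "B > 0" using K t by (simp add: B_def)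
    interpret bounded_multiplier b 3 B
    proof
      show ib: "integrable lborel b"
      proof (rule Bochner_Integration.integrable_bound)
        show "integrable lborel (\<lambda>y::real^'n. 3 * damped_weight s t y)" using int[OF t] by simp
        show "AE y in lborel. norm (b y) \<le> norm (3 * damped_weight s t y)"
          unfolding real_norm_def by (intro AE_I2 order_trans[OF b abs_ge_self])
      qed (use bm in simp)
      show "\<bar>b y\<bar> \<le> 3" for y
        using b[of y] damped_weight_le_1[of s t y] s t by simp
      have "(LINT y|lborel. \<bar>b y\<bar>) \<le> (LINT y|lborel. 3 * damped_weight s t (y::real^'n))"
        by (rule Bochner_Integration.integral_mono) (use ib int[OF t] b in auto)
      also have "\<dots> \<le> 3 * (K * t powr (- ?n / 2))" using le[OF t] by simp
      also have "\<dots> = ?P * B" by (simp add: B_def)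
      finally show "(LINT y|lborel. \<bar>b y\<bar>) \<le> ?P * B" .
    qed
    let ?e = "1 - 2 * enn2real (1 / p)"
    have "enn2real (1 / p) \<le> 1 / 2"
    proof (cases p)
      case (real P)
      then have "2 \<le> P" using p(1) ennreal_le_iff[of P 2] by simp
      then show ?thesis using real divide_ennreal[of 1 P] by simp
    qed simp
    moreover have "0 \<le> enn2real (1 / p)" by simp
    ultimately have e: "0 \<le> ?e" "?e \<le> 1" by auto
    have "3 powr (2 * enn2real (1 / p)) * B powr ?e = 3 * ((K / ?P) powr ?e * t powr (- (?n / 2) * ?e))"
    proof -
      have "B powr ?e = 3 powr ?e * ((K / ?P) powr ?e * (t powr (- ?n / 2)) powr ?e)"
        unfolding B_def using K t by (simp add: powr_mult powr_divide mult.assoc)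
      moreover have "(3::real) powr (2 * enn2real (1 / p)) * 3 powr ?e = 3"
        by (simp flip: powr_add)
      moreover have "(t powr (- ?n / 2)) powr ?e = t powr (- (?n / 2) * ?e)"
        by (simp add: powr_powr)
      ultimately show ?thesis by (simp only: mult.assoc[symmetric])
    qed
    also have "\<dots> \<le> 3 * (max 1 (K / ?P) * t powr (- (?n / 2) * ?e))"
    proof (intro mult_left_mono mult_right_mono)
      have "(K / ?P) powr ?e \<le> max 1 (K / ?P) powr ?e"
        using e K by (intro powr_mono2) auto
      also have "\<dots> \<le> max 1 (K / ?P) powr 1"
        using e by (intro powr_mono) auto
      finally show "(K / ?P) powr ?e \<le> max 1 (K / ?P)" by simp
    qed auto
    finally have "exp 1 * (3 powr (2 * enn2real (1 / p)) * B powr ?e) \<le> exp 1 * (3 * (max 1 (K / ?P) * t powr (- (?n / 2) * ?e)))"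
      by (rule mult_left_mono) simp
    then have "exp 1 * 3 powr (2 * enn2real (1 / p)) * B powr ?e \<le> C * t powr (- (?n / 2) * ?e)"
      by (simp only: C_def mult.assoc)
    then have "ennreal (exp 1 * 3 powr (2 * enn2real (1 / p)) * B powr ?e) * Lp_norm q f \<le>
      ennreal (C * t powr (- (?n / 2) * ?e)) * Lp_norm q f"
      by (intro mult_right_mono ennreal_leI) auto
    with Lp_norm_multiplier_le[OF f _ B p] show ?thesis by simp
  qed
  with C show ?thesis by blast
qed

text \<open>The symbol \<open>b\<close> is taken relative to \<open>h\<close>, which will be
  \<open>g\<close> or \<open>g - laplacian g\<close> according to the norm on the right. The second
  bound in \<open>R\<close> covers the alternative in which the transform of the inner function has
  the default value \<open>0\<close>.\<close>

lemma bessel_norm_multiplier_le: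
  fixes g h :: "real^'n::finite \<Rightarrow> complex" and a b :: "real^'n \<Rightarrow> real"
  assumes g: "g \<in> schwartz" and a: "continuous_on UNIV a" "\<And>y. \<bar>a y\<bar> \<le> K * (1 + (norm y)\<^sup>2)"
    and b: "\<And>y. complex_of_real ((1 + (norm y)\<^sup>2) powr (s / 2)) * (complex_of_real (a y) * fourier g y) = complex_of_real (b y) * fourier h y"
    and R: "Lp_norm p (fourier_multiplier b h) \<le> R" "Lp_norm p (fourier_multiplier (\<lambda>_. 0) h) \<le> R"
  shows "bessel_norm s p (inv_fourier (\<lambda>y. complex_of_real (a y) * fourier g y)) \<le> R"
proof -
  let ?F = "\<lambda>y. complex_of_real (a y) * fourier g y"
  have "fourier (inv_fourier ?F) = ?F \<or> fourier (inv_fourier ?F) = (\<lambda>_. 0)"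
    using g a by (intro fourier_inv_fourier_or_zero integrable_symbol_fourier continuous_symbol_fourier bounded_symbol_fourier)
  then show ?thesis
  proof
    assume "fourier (inv_fourier ?F) = ?F"
    then have "bessel_op s (inv_fourier ?F) = fourier_multiplier b h"
      unfolding bessel_op_def fourier_multiplier_def by (simp only: b)
    then show ?thesis using R by (simp add: bessel_norm_def)
  next
    assume "fourier (inv_fourier ?F) = (\<lambda>_. 0)"
    then have "bessel_op s (inv_fourier ?F) = fourier_multiplier (\<lambda>_. 0) h"
      unfolding bessel_op_def fourier_multiplier_def by simp
    then show ?thesis using R by (simp add: bessel_norm_def)
  qed
qed

lemma powr_half_shift:
  fixes j :: real
  assumes "0 < j"
  shows "j powr (s / 2) * sqrt j ^ m = j powr ((s + real m) / 2)"
proof -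
  have "sqrt j ^ m = sqrt j powr real m" using assms by (intro powr_realpow[symmetric]) simp
  also have "\<dots> = j powr (real m / 2)" using assms by (simp add: powr_powr flip: powr_half_sqrt)
  finally show ?thesis by (simp add: powr_add[symmetric] add_divide_distrib)
qed

text \<open>Bookkeeping of orders: a symbol of growth order \<open>m\<close>, weighted with order
  \<open>s\<close>, is majorised by the damped weight of total order \<open>s + m\<close>.\<close>

lemma weighted_symbol_le:
  assumes x: "\<bar>x\<bar> \<le> c * sqrt (1 + (norm y)\<^sup>2) ^ m * exp (- (damping y * t))" and c: "0 \<le> c" "c \<le> 3"
    and s: "s + real m = - r"
  shows "\<bar>(1 + (norm y)\<^sup>2) powr (s / 2) * x\<bar> \<le> 3 * damped_weight r t y"
proof -
  let ?j = "1 + (norm y)\<^sup>2"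
  have "\<bar>?j powr (s / 2) * x\<bar> \<le> ?j powr (s / 2) * (c * sqrt ?j ^ m * exp (- (damping y * t)))"
    using x by (simp add: abs_mult mult_left_mono)
  also have "\<dots> = c * (?j powr (s / 2) * sqrt ?j ^ m * exp (- (damping y * t)))" by simp
  also have "\<dots> = c * damped_weight r t y"
    unfolding powr_half_shift[OF Japanese_pos] s damped_weight_eq by simp
  also have "\<dots> \<le> 3 * damped_weight r t y"
    using c damped_weight_pos[of r t y] by (intro mult_right_mono) auto
  finally show ?thesis .
qed

lemma continuous_on_symbol_m_1: "continuous_on UNIV (\<lambda>y::real^'n::finite. symbol_m_1 y t)"
proof -
  have "root_factor y \<noteq> 0" for y :: "real^'n" using root_factor_pos[of y] by simp
  then show ?thesis unfolding symbol_m_1_def by (intro continuous_intros ballI)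
qed

lemma continuous_on_symbol_m_2: "continuous_on UNIV (\<lambda>y::real^'n::finite. symbol_m_2 y t)"
proof -
  have "root_factor y \<noteq> 0" for y :: "real^'n" using root_factor_pos[of y] by simp
  then show ?thesis unfolding symbol_m_2_def by (intro continuous_intros ballI)
qed

lemma continuous_on_norm_sq_symbol_m: "continuous_on UNIV (\<lambda>y::real^'n::finite. (norm y)\<^sup>2 * symbol_m y t)"
proof -
  have "root_factor y \<noteq> 0" for y :: "real^'n" using root_factor_pos[of y] by simp
  then show ?thesis unfolding norm_sq_symbol_m by (intro continuous_intros ballI)
qed

text \<open>A crude bound that serves only the growth condition for Fourier inversion; its constant
  does not enter the estimate.\<close>

lemma abs_le_JapaneseI:
  assumes x: "\<bar>x\<bar> \<le> c * sqrt (1 + (norm y)\<^sup>2) ^ m * exp (- (damping y * t))"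
    and "0 \<le> c" "c \<le> 3" "m \<le> 2" "0 \<le> t"
  shows "\<bar>x\<bar> \<le> 3 * (1 + (norm y)\<^sup>2)"
proof -
  let ?j = "sqrt (1 + (norm y)\<^sup>2)"
  have "c * ?j ^ m * exp (- (damping y * t)) \<le> 3 * ?j ^ 2 * 1"
    using assms damping_nonneg[of y] by (intro mult_mono power_increasing) auto
  also have "\<dots> = 3 * (1 + (norm y)\<^sup>2)"
    using Japanese_pos[of y] by simp
  finally show ?thesis using x by linarith
qed

text \<open>The order of the norm on the left, minus that on the right, plus the growth order of the
  symbol is the same in all four cases: \<open>(\<sigma> - 1) - 0 + 0\<close> and
  \<open>(\<sigma> - 2) - 0 + 1\<close> for the first estimate, \<open>\<sigma> - 2 + 1\<close> and
  \<open>(\<sigma> - 1) - 2 + 2\<close> for the second. Its value is always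
  \<open>\<sigma> - 1\<close>, below \<open>- n\<close> by hypothesis.\<close>

theorem lemma3p10:
  fixes \<sigma> :: real
  assumes "\<sigma> < 1 - real CARD('n::finite)"
  shows "\<exists>C>0. \<forall>p q :: ennreal. 2 \<le> p \<longrightarrow> 1 / p + 1 / q = 1 \<longrightarrow>
    (\<forall>g \<in> (schwartz :: (real^'n \<Rightarrow> complex) set). \<forall>k\<in>{1, 2 :: nat}. \<forall>t>0.
       bessel_norm (\<sigma> - real k) p (dt_S k t g)
         \<le> ennreal (C * t powr (- (real CARD('n) / 2) * (1 - 2 * enn2real (1 / p)))) * Lp_norm q g \<and>
       bessel_norm (\<sigma> - real k + 1) p (dt_S (k - 1) t (laplacian g))
         \<le> ennreal (C * t powr (- (real CARD('n) / 2) * (1 - 2 * enn2real (1 / p)))) * bessel_norm 2 q g)"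
proof -
  define r where "r = 1 - \<sigma>"
  have "r > real CARD('n)" using assms by (simp add: r_def)
  then obtain C where C: "C > 0" and est: "\<And>(p::ennreal) q b (f :: real^'n \<Rightarrow> complex) t.
      2 \<le> p \<Longrightarrow> 1 / p + 1 / q = 1 \<Longrightarrow> t > 0 \<Longrightarrow> b \<in> borel_measurable borel \<Longrightarrow>
      (\<And>y. \<bar>b y\<bar> \<le> 3 * damped_weight r t y) \<Longrightarrow> integrable lborel f \<Longrightarrow>
      Lp_norm p (fourier_multiplier b f) \<le>
        ennreal (C * t powr (- (real CARD('n) / 2) * (1 - 2 * enn2real (1 / p)))) * Lp_norm q f"
    using Lp_norm_damped_multiplier_le[where 'n='n] by (metis (no_types, lifting))
  show ?thesis
  proof (intro exI[of _ C] conjI[OF C] allI impI ballI, rule conjI)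
    fix p q :: ennreal and g :: "real^'n \<Rightarrow> complex" and k :: nat and t :: real
    assume p: "2 \<le> p" "1 / p + 1 / q = 1" and g: "g \<in> schwartz" and k: "k \<in> {1, 2}" and t: "0 < t"
    let ?R = "ennreal (C * t powr (- (real CARD('n) / 2) * (1 - 2 * enn2real (1 / p))))"
    \<comment> \<open>The zero symbol lies below the same majorant, which settles the default
      alternative in the inversion.\<close>
    have zero: "Lp_norm p (fourier_multiplier (\<lambda>_. 0) f) \<le> ?R * Lp_norm q f" if "integrable lborel f" for f :: "real^'n \<Rightarrow> complex"
      by (rule est[OF p t _ _ that]) (simp_all add: less_imp_le[OF damped_weight_pos])
    \<comment> \<open>Here \<open>u\<close> is the order of the norm on the right, \<open>0\<close>
      with \<open>h = g\<close> or \<open>2\<close> with \<open>h = g - laplacian g\<close>, and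
      \<open>m\<close> is the growth order of the symbol \<open>a\<close>.\<close>
    have main: "bessel_norm s p (inv_fourier (\<lambda>y. complex_of_real (a y) * fourier g y)) \<le> ?R * Lp_norm q h"
      if a: "continuous_on UNIV a" "\<And>y. \<bar>a y\<bar> \<le> c * sqrt (1 + (norm y)\<^sup>2) ^ m * exp (- (damping y * t))"
        and c: "0 \<le> c" "c \<le> 3" "m \<le> 2"
        and h: "h \<in> schwartz" "\<And>y. fourier h y = complex_of_real ((1 + (norm y)\<^sup>2) powr (u / 2)) * fourier g y"
        and s: "s - u + real m = - r"
      for a and s u c :: real and m h
    proof (rule bessel_norm_multiplier_le[OF g a(1)])
      let ?b = "\<lambda>y. (1 + (norm y)\<^sup>2) powr ((s - u) / 2) * a y"
      show "\<bar>a y\<bar> \<le> 3 * (1 + (norm y)\<^sup>2)" for y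
        by (rule abs_le_JapaneseI[OF a(2) c]) (use t in simp)
      have "(1 + (norm y)\<^sup>2) powr (s / 2) = (1 + (norm y)\<^sup>2) powr ((s - u) / 2) * (1 + (norm y)\<^sup>2) powr (u / 2)" for y :: "real^'n"
        by (simp add: powr_add[symmetric] diff_divide_distrib)
      then show "complex_of_real ((1 + (norm y)\<^sup>2) powr (s / 2)) * (complex_of_real (a y) * fourier g y) = complex_of_real (?b y) * fourier h y" for y
        by (simp add: h(2))
      have [measurable]: "a \<in> borel_measurable borel" by (rule borel_measurable_continuous_onI[OF a(1)])
      show "Lp_norm p (fourier_multiplier ?b h) \<le> ?R * Lp_norm q h"
        by (rule est[OF p t _ weighted_symbol_le[OF a(2) c(1,2) s] schwartz_integrable[OF h(1)]]) measurable
      show "Lp_norm p (fourier_multiplier (\<lambda>_. 0) h) \<le> ?R * Lp_norm q h"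
        by (rule zero[OF schwartz_integrable[OF h(1)]])
    qed
    let ?h = "\<lambda>x. g x - laplacian g x"
    have h: "?h \<in> schwartz" "fourier ?h y = complex_of_real ((1 + (norm y)\<^sup>2) powr (2 / 2)) * fourier g y" for y
      using Japanese_pos[of y] by (simp_all add: schwartz_minus_laplacian g fourier_minus_laplacian)
    have g0: "fourier g y = complex_of_real ((1 + (norm y)\<^sup>2) powr (0 / 2)) * fourier g y" for y
      using Japanese_pos[of y] by simp
    have m1: "\<bar>symbol_m_1 y t\<bar> \<le> 2 * sqrt (1 + (norm y)\<^sup>2) ^ 0 * exp (- (damping y * t))" for y :: "real^'n"
      using abs_symbol_m_1_le by simp
    have m2: "\<bar>symbol_m_2 y t\<bar> \<le> 3 * sqrt (1 + (norm y)\<^sup>2) ^ 1 * exp (- (damping y * t))" for y :: "real^'n"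
      using abs_symbol_m_2_le by simp
    have m0: "\<bar>- ((norm y)\<^sup>2 * symbol_m y t)\<bar> \<le> 2 * sqrt (1 + (norm y)\<^sup>2) ^ 1 * exp (- (damping y * t))" for y :: "real^'n"
      unfolding abs_minus_cancel using abs_norm_sq_symbol_m_le by simp
    have m1': "\<bar>- ((norm y)\<^sup>2 * symbol_m_1 y t)\<bar> \<le> 2 * sqrt (1 + (norm y)\<^sup>2) ^ 2 * exp (- (damping y * t))" for y :: "real^'n"
    proof -
      have "(norm y)\<^sup>2 * \<bar>symbol_m_1 y t\<bar> \<le> (1 + (norm y)\<^sup>2) * (2 * exp (- (damping y * t)))"
        by (intro mult_mono abs_symbol_m_1_le) auto
      then show ?thesis using Japanese_pos[of y] by (simp add: abs_mult algebra_simps)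
    qed
    have *: "dt_S k t g = inv_fourier (\<lambda>y. complex_of_real ((deriv ^^ k) (symbol_m y) t) * fourier g y)" for k
      by (simp add: dt_S_def fourier_multiplier_def)
    \<comment> \<open>The Laplacian is absorbed into the symbol, sign included, so that the
      transform of \<open>g\<close> itself remains. This also removes the singular quotient when no
      time derivative is taken.\<close>
    have **: "dt_S k t (laplacian g) = inv_fourier (\<lambda>y. complex_of_real (- ((norm y)\<^sup>2 * (deriv ^^ k) (symbol_m y) t)) * fourier g y)" for k
      unfolding dt_S_def fourier_multiplier_def fourier_laplacian[OF g]
      by (intro arg_cong[of _ _ inv_fourier] ext) simp
    have d: "deriv ^^ 2 = (\<lambda>f::real\<Rightarrow>real. deriv (deriv f))" "deriv ^^ Suc 0 = (\<lambda>f::real\<Rightarrow>real. deriv f)"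
      by (auto simp: numeral_2_eq_2)
    show "bessel_norm (\<sigma> - real k) p (dt_S k t g) \<le> ?R * Lp_norm q g"
    proof (cases "k = 1")
      case True
      show ?thesis
        unfolding * True using main[OF continuous_on_symbol_m_1 m1 _ _ _ g g0, of "\<sigma> - 1"]
        by (simp add: deriv_symbol_m r_def)
    next
      case False
      then have k2: "k = 2" using k by simp
      show ?thesis
        unfolding * k2 d using main[OF continuous_on_symbol_m_2 m2 _ _ _ g g0, of "\<sigma> - 2"]
        by (simp add: deriv_symbol_m deriv_symbol_m_1 r_def)
    qed
    show "bessel_norm (\<sigma> - real k + 1) p (dt_S (k - 1) t (laplacian g)) \<le> ?R * bessel_norm 2 q g"
    proof (cases "k = 1")
      case True
      show ?thesis
        unfolding ** True bessel_norm_def[of 2] bessel_op_2[OF g]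
        using main[OF continuous_on_minus[OF continuous_on_norm_sq_symbol_m] m0 _ _ _ h, of \<sigma>]
        by (simp add: r_def)
    next
      case False
      then have k2: "k = 2" using k by simp
      have "continuous_on UNIV (\<lambda>y::real^'n. - ((norm y)\<^sup>2 * symbol_m_1 y t))"
        by (intro continuous_intros continuous_on_symbol_m_1)
      from main[OF this m1' _ _ _ h, of "\<sigma> - 1"] show ?thesis
        unfolding ** k2 bessel_norm_def[of 2] bessel_op_2[OF g]
        by (simp add: deriv_symbol_m r_def)
    qed
  qed
qed

end
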